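(* Let $T$, $\Sigma$, $\lambda_i^0$, $R$ and the functional calculus be as in the context, and let $m_i$ be the index of the eigenvalue $\lambda_i^0$. For each fixed $i\in\{1,\dots,N\}$ there exists a constant $C>0$ such that for all $h\in H^\infty(\Sigma)$ satisfying $h(z)=0$ for all $z\in\Sigma$ with $z\notin\{\zeta\in\mathbb C:|\lambda_i^0-\zeta|<R\}$, $$\|h(T)\|\le C\max_{0\le j\le m_i-1}|h^{(j)}(\lambda_i^0)|.$$
   Context: $\mathbf D(\cdot),\mathbf R(\cdot),\mathbf N(\cdot)$ denote domain, range and null space; $\sigma,\rho$ spectrum and resolvent set. $\Omega\subset\mathbb R^n$ is a bounded weakly Lipschitz domain: a bounded open set such that, with $\Gamma=\partial\Omega$, $\Omega^+=\Omega$, $\Omega^-=\mathbb R^n\setminus\overline\Omega$, for each $y\in\Gamma$ there are a neighbourhood $V_y$ of $y$ and a bilipschitz map $\rho_y:\mathbb R^n\to\mathbb R^n$ with $\Omega^\pm\cap V_y=\rho_y(\mathbb R^n_\pm)\cap V_y$ and $\Gamma\cap V_y=\rho_y(\mathbb R^{n-1}\times\{0\})\cap V_y$, where $\mathbb R^n_\pm=\{x:\pm x_n>0\}$. $B\in L_\infty(\Omega;\mathbb C^{M\times M})$ is a pointwise strictly accretive multiplication operator on $L_2(\Omega;\mathbb C^M)$: there is $\beta>0$ with $\mathrm{Re}(B(x)v,v)\ge\beta|v|^2$ for a.e. $x\in\Omega$ and all $v\in\mathbb C^M$. $D$ is an (unbounded) operator in $L_2(\Omega;\mathbb C^M)$ with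 closed range such that: (1) $D=D_1+D_0$ with $D_0$ bounded on $L_2(\Omega;\mathbb C^M)$ and $D_1$ a self-adjoint homogeneous first-order differential operator with constant coefficients and local boundary conditions (i.e. $\mathbf D(D_1)$ is stable under multiplication by restrictions of smooth compactly supported scalar functions); (2) $(\lambda-D|_{\mathbf R(D)})^{-1}$ is compact for some, and therefore all, $\lambda\in\rho(D|_{\mathbf R(D)})$, where $D|_{\mathbf R(D)}$ is $D$ regarded as an operator in $\mathbf R(D)$ with domain $\mathbf D(D)\cap\mathbf R(D)$. $\mathcal H:=\mathbf R(D)$ and $T:=DB|_{\mathcal H}:\mathcal H\to\mathcal H$ with domain $\mathbf D(DB)\cap\mathcal H$; it is closed, densely defined, with compact resolvent. Let $\omega=\operatorname{ess\,sup}_{x}\sup_{v\ne0}|\arg(B(x)v,v)|<\pi/2$ and, for $\alpha\in[0,\pi/2)$, $\tau\ge0$, $S_{\alpha,\tau}=\{x+iy:|y|<|x|\tan\alpha+\tau\}$. Fix $\tau>0$ such that $\sigma(DB)\subset S_{\omega,\tau}$ and, for some $C$, $\|(\lambda-DB)^{-1}\|\le C/\mathrm{dist}(\lambda,\{x+iy:|y|\le|x|\tan\omega\})$ for all $\lambda\notin S_{\omega,\tau}$ (such $\tau$ exists). There are only finitely many eigenvalues of $T$ on the imaginary axis, denoted $\lambda_1^0,\dots,\lambda_N^0$ (distinct). Fix $0<R<a$ such that $\sigma(T)\cap\{|\mathrm{Re}\,\zeta|\le a\}=\{\lambda_i^0\}_{i=1}^N$ and the closed discs $\{|\zeta-\lambda_i^0|\le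 R\}$ are pairwise disjoint and contained in $S_{\omega,\tau}$. Fix $\mu\in(\omega,\pi/2)$ and set $\Sigma^\pm=\{\zeta:\pm\mathrm{Re}\,\zeta>a,\ |\mathrm{Im}\,\zeta|<\tau+|\mathrm{Re}\,\zeta|\tan\mu\}$, $\Sigma^0=\bigcup_{i=1}^N\{|\zeta-\lambda_i^0|<R\}$, $\Sigma=\Sigma^-\cup\Sigma^+\cup\Sigma^0$. $H^\infty(\Sigma)$ is the set of bounded holomorphic functions on $\Sigma$; $\Theta(\Sigma)$ is the set of $\psi\in H^\infty(\Sigma)$ with $|\psi(z)|\le C|z|^{-\alpha}$ on $\Sigma$ for some $C,\alpha>0$ (functions $h$ as in the claim belong to $\Theta(\Sigma)$). For $\nu\in(\omega,\mu)$, $0<r<R$ and $b>a$ with $\sigma(T)\cap\{a\le|\mathrm{Re}\,\zeta|\le b\}=\emptyset$, let $\gamma^\pm$ be the boundary of $\{\pm\mathrm{Re}\,\zeta>b,\ |\mathrm{Im}\,\zeta|<\tau+|\mathrm{Re}\,\zeta|\tan\nu\}$, $\gamma^0=\bigcup_i\{|\zeta-\lambda_i^0|=r\}$, $\gamma=\gamma^-\cup\gamma^+\cup\gamma^0$, all oriented anti-clockwise. For $\psi\in\Theta(\Sigma)$, $\psi(T)=\frac1{2\pi i}\int_\gamma\psi(\zeta)(\zeta-T)^{-1}d\zeta$ (absolutely convergent, independent of $r,\nu,b$). The index of an eigenvalue $\lambda$ of $T$ is the smallest nonnegative integer $m$ with $\mathbf N((\lambda-T)^m)=\mathbf N((\lambda-T)^{m+1})$;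 the indices $m_i$ are finite. *)

theory Defs
  imports "HOL-Complex_Analysis.Complex_Analysis" "HOL-Probability.Essential_Supremum"
begin

definition sq_integrable :: "('a::euclidean_space \<Rightarrow> 'b::euclidean_space) \<Rightarrow> bool" where
  "sq_integrable f \<longleftrightarrow>
     f \<in> borel_measurable lebesgue \<and> integrable lebesgue (\<lambda>x. (norm (f x))\<^sup>2)"

definition l2_rel ::
    "('a::euclidean_space \<Rightarrow> 'b::euclidean_space) \<Rightarrow> ('a \<Rightarrow> 'b) \<Rightarrow> bool" where
  "l2_rel f g \<longleftrightarrow> sq_integrable f \<and> sq_integrable g \<and> (AE x in lebesgue. f x = g x)"

lemma sq_integrable_zero: "sq_integrable (\<lambda>x. 0)"
  by (simp add: sq_integrable_def)

lemma sq_integrable_add: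
  assumes "sq_integrable f" "sq_integrable g"
  shows "sq_integrable (\<lambda>x. f x + g x)"
proof -
  have m: "f \<in> borel_measurable lebesgue" "g \<in> borel_measurable lebesgue"
    using assms by (auto simp: sq_integrable_def)
  have "integrable lebesgue (\<lambda>x. 2 * (norm (f x))\<^sup>2 + 2 * (norm (g x))\<^sup>2)"
    using assms by (auto simp: sq_integrable_def)
  moreover have "(\<lambda>x. (norm (f x + g x))\<^sup>2) \<in> borel_measurable lebesgue"
    using m by measurable
  moreover have "(norm (f x + g x))\<^sup>2 \<le> 2 * (norm (f x))\<^sup>2 + 2 * (norm (g x))\<^sup>2" for x
  proof -
    have "(norm (f x + g x))\<^sup>2 \<le> (norm (f x) + norm (g x))\<^sup>2"
      by (intro power_mono norm_triangle_ineq) auto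
    also have "\<dots> \<le> 2 * (norm (f x))\<^sup>2 + 2 * (norm (g x))\<^sup>2"
      using sum_squares_ge_zero[of "norm (f x) - norm (g x)" 0]
      by (simp add: power2_eq_square algebra_simps)
    finally show ?thesis .
  qed
  ultimately have "integrable lebesgue (\<lambda>x. (norm (f x + g x))\<^sup>2)"
    by (intro Bochner_Integration.integrable_bound[where
          g = "\<lambda>x. (norm (f x + g x))\<^sup>2" and f = "\<lambda>x. 2 * (norm (f x))\<^sup>2 + 2 * (norm (g x))\<^sup>2"]) auto
  then show ?thesis using m by (auto simp: sq_integrable_def)
qed

lemma sq_integrable_scaleR:
  assumes "sq_integrable f"
  shows "sq_integrable (\<lambda>x. c *\<^sub>R f x)"
  using assms by (auto simp: sq_integrable_def power_mult_distrib)

lemma integrable_inner: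
  assumes "sq_integrable f" "sq_integrable g"
  shows "integrable lebesgue (\<lambda>x. f x \<bullet> g x)"
proof -
  have m: "f \<in> borel_measurable lebesgue" "g \<in> borel_measurable lebesgue"
    using assms by (auto simp: sq_integrable_def)
  have b: "\<bar>f x \<bullet> g x\<bar> \<le> (norm (f x))\<^sup>2 + (norm (g x))\<^sup>2" for x
  proof -
    have "\<bar>f x \<bullet> g x\<bar> \<le> norm (f x) * norm (g x)"
      by (rule Cauchy_Schwarz_ineq2)
    also have "\<dots> \<le> (norm (f x))\<^sup>2 + (norm (g x))\<^sup>2"
      using sum_squares_bound[of "norm (f x)" "norm (g x)"]
        mult_nonneg_nonneg[of "norm (f x)" "norm (g x)"]
      by (simp add: mult.assoc del: mult_nonneg_nonneg zero_le_mult_iff)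
    finally show ?thesis .
  qed
  have "integrable lebesgue (\<lambda>x. (norm (f x))\<^sup>2 + (norm (g x))\<^sup>2)"
    using assms by (auto simp: sq_integrable_def)
  moreover have "(\<lambda>x. f x \<bullet> g x) \<in> borel_measurable lebesgue"
    using m by measurable
  ultimately show ?thesis
    by (rule Bochner_Integration.integrable_bound) (use b in auto)
qed

lemma l2_rel_part_equivp: "part_equivp (l2_rel :: ('a::euclidean_space \<Rightarrow> 'b::euclidean_space) \<Rightarrow> _)"
proof (rule part_equivpI)
  show "\<exists>x. l2_rel x (x :: 'a \<Rightarrow> 'b)"
    by (rule exI[of _ "\<lambda>x. 0"]) (simp add: l2_rel_def sq_integrable_zero)
  show "symp (l2_rel :: ('a \<Rightarrow> 'b) \<Rightarrow> _)"
    by (rule sympI) (auto simp: l2_rel_def)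
  show "transp (l2_rel :: ('a \<Rightarrow> 'b) \<Rightarrow> _)"
    by (rule transpI) (auto simp: l2_rel_def elim: eventually_elim2)
qed

text \<open>
  \<open>('a, 'b) l2\<close> is the space of square integrable functions on the whole of \<open>'a\<close>, modulo
  equality almost everywhere. \<open>abs_l2 f\<close> is the class of \<open>f\<close> (meaningful for square integrable
  \<open>f\<close>), and \<open>rep_l2 u\<close> is some representative of \<open>u\<close>.
\<close>

quotient_type (overloaded) ('a, 'b) l2 =
  "'a::euclidean_space \<Rightarrow> 'b::euclidean_space" / partial: l2_rel
  morphisms rep_l2 abs_l2
  by (rule l2_rel_part_equivp)

instantiation l2 :: (euclidean_space, euclidean_space) real_inner
begin

lift_definition zero_l2 :: "('a, 'b) l2" is "\<lambda>x. 0"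
  by (simp add: l2_rel_def sq_integrable_zero)

lift_definition plus_l2 :: "('a, 'b) l2 \<Rightarrow> ('a, 'b) l2 \<Rightarrow> ('a, 'b) l2" is
  "\<lambda>f g x. f x + g x"
  by (auto simp: l2_rel_def sq_integrable_add elim: eventually_elim2)

lift_definition scaleR_l2 :: "real \<Rightarrow> ('a, 'b) l2 \<Rightarrow> ('a, 'b) l2" is
  "\<lambda>c f x. c *\<^sub>R f x"
  by (auto simp: l2_rel_def sq_integrable_scaleR elim: eventually_mono)

lift_definition uminus_l2 :: "('a, 'b) l2 \<Rightarrow> ('a, 'b) l2" is "\<lambda>f x. - f x"
  using sq_integrable_scaleR[where c = "-1"]
  by (auto simp: l2_rel_def elim: eventually_mono)

definition minus_l2 :: "('a, 'b) l2 \<Rightarrow> ('a, 'b) l2 \<Rightarrow> ('a, 'b) l2" where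
  "minus_l2 u v = u + (- v)"

lift_definition inner_l2 :: "('a, 'b) l2 \<Rightarrow> ('a, 'b) l2 \<Rightarrow> real" is
  "\<lambda>f g. \<integral>x. f x \<bullet> g x \<partial>lebesgue"
proof -
  fix f f' g g' :: "'a \<Rightarrow> 'b"
  assume a: "l2_rel f f'" "l2_rel g g'"
  have m: "f \<in> borel_measurable lebesgue" "f' \<in> borel_measurable lebesgue"
    "g \<in> borel_measurable lebesgue" "g' \<in> borel_measurable lebesgue"
    using a by (auto simp: l2_rel_def sq_integrable_def)
  show "(\<integral>x. f x \<bullet> g x \<partial>lebesgue) = (\<integral>x. f' x \<bullet> g' x \<partial>lebesgue)"
  proof (rule integral_cong_AE)
    show "AE x in lebesgue. f x \<bullet> g x = f' x \<bullet> g' x"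
      using a by (auto simp: l2_rel_def elim: eventually_elim2)
  qed (use m in measurable)
qed

definition norm_l2 :: "('a, 'b) l2 \<Rightarrow> real" where
  "norm_l2 u = sqrt (inner u u)"

definition sgn_l2 :: "('a, 'b) l2 \<Rightarrow> ('a, 'b) l2" where
  "sgn_l2 u = inverse (norm u) *\<^sub>R u"

definition dist_l2 :: "('a, 'b) l2 \<Rightarrow> ('a, 'b) l2 \<Rightarrow> real" where
  "dist_l2 u v = norm (u - v)"

definition uniformity_l2 :: "(('a, 'b) l2 \<times> ('a, 'b) l2) filter" where
  "uniformity_l2 = (INF e\<in>{0 <..}. principal {(u, v). dist u v < e})"

definition open_l2 :: "('a, 'b) l2 set \<Rightarrow> bool" where
  "open_l2 U \<longleftrightarrow> (\<forall>u\<in>U. eventually (\<lambda>(u', v). u' = u \<longrightarrow> v \<in> U) uniformity)"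

instance
proof
  fix u v w :: "('a, 'b) l2" and c d :: real
  show "u + v + w = u + (v + w)"
    by transfer (auto simp: l2_rel_def add.assoc intro!: sq_integrable_add)
  show "u + v = v + u"
    by transfer (auto simp: l2_rel_def add.commute intro!: sq_integrable_add)
  show "0 + u = u"
    by transfer (auto simp: l2_rel_def)
  show "- u + u = 0"
    by transfer (auto simp: l2_rel_def sq_integrable_zero)
  show "u - v = u + (- v)"
    by (simp add: minus_l2_def)
  show "c *\<^sub>R (u + v) = c *\<^sub>R u + c *\<^sub>R v"
    by transfer (auto simp: l2_rel_def scaleR_add_right
        intro!: sq_integrable_add sq_integrable_scaleR)
  show "(c + d) *\<^sub>R u = c *\<^sub>R u + d *\<^sub>R u"
    by transfer (auto simp: l2_rel_def scaleR_add_left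
        intro!: sq_integrable_add sq_integrable_scaleR)
  show "c *\<^sub>R d *\<^sub>R u = (c * d) *\<^sub>R u"
    by transfer (auto simp: l2_rel_def intro!: sq_integrable_scaleR)
  show "1 *\<^sub>R u = u"
    by transfer (auto simp: l2_rel_def)
  show "inner u v = inner v u"
    by transfer (simp add: inner_commute)
  show "inner (u + v) w = inner u w + inner v w"
    by transfer (auto simp: l2_rel_def inner_add_left integrable_inner)
  show "inner (c *\<^sub>R u) v = c * inner u v"
    by transfer simp
  show "0 \<le> inner u u"
    by transfer simp
  show "inner u u = 0 \<longleftrightarrow> u = 0"
  proof transfer
    fix f :: "'a \<Rightarrow> 'b"
    assume f: "l2_rel f f"
    then have i: "integrable lebesgue (\<lambda>x. f x \<bullet> f x)"
      by (auto simp: l2_rel_def integrable_inner)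
    show "(\<integral>x. f x \<bullet> f x \<partial>lebesgue) = 0 \<longleftrightarrow> l2_rel f (\<lambda>x. 0)"
      using f integral_nonneg_eq_0_iff_AE[OF i]
      by (auto simp: l2_rel_def sq_integrable_zero)
  qed
qed (simp_all add: norm_l2_def sgn_l2_def dist_l2_def uniformity_l2_def open_l2_def)

end

text \<open>
  \<open>L\<^sub>2(\<Omega>; \<complex>\<^sup>M)\<close> is the closed subspace of those classes that vanish almost everywhere outside
  \<open>\<Omega>\<close> (extension by zero).
\<close>

type_synonym ('n, 'm) L2 = "(real^'n, complex^'m) l2"

definition L2 :: "(real^'n) set \<Rightarrow> ('n::finite, 'm::finite) L2 set" where
  "L2 \<Omega> = {u. AE x in lebesgue. x \<notin> \<Omega> \<longrightarrow> rep_l2 u x = 0}"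

definition hdot :: "complex^'m \<Rightarrow> complex^'m \<Rightarrow> complex" where
  "hdot v w = (\<Sum>k\<in>UNIV. v $ k * cnj (w $ k))"

definition cinner :: "('n::finite, 'm::finite) L2 \<Rightarrow> ('n, 'm) L2 \<Rightarrow> complex" where
  "cinner u v = (\<integral>x. hdot (rep_l2 u x) (rep_l2 v x) \<partial>lebesgue)"

definition cscale :: "complex \<Rightarrow> ('n::finite, 'm::finite) L2 \<Rightarrow> ('n, 'm) L2" where
  "cscale c u = abs_l2 (\<lambda>x. c *s rep_l2 u x)"

definition scalar_mult_op ::
    "(real^'n) set \<Rightarrow> (real^'n \<Rightarrow> complex) \<Rightarrow> ('n::finite, 'm::finite) L2 \<Rightarrow> ('n, 'm) L2" where
  "scalar_mult_op \<Omega> \<eta> u = abs_l2 (\<lambda>x. if x \<in> \<Omega> then \<eta> x *s rep_l2 u x else 0)"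

definition matrix_mult_op ::
    "(real^'n) set \<Rightarrow> (real^'n \<Rightarrow> complex^'m^'m) \<Rightarrow> ('n::finite, 'm::finite) L2 \<Rightarrow> ('n, 'm) L2" where
  "matrix_mult_op \<Omega> B u = abs_l2 (\<lambda>x. if x \<in> \<Omega> then B x *v rep_l2 u x else 0)"

text \<open>
  An operator in a subspace \<open>X\<close> is represented by its graph \<open>A \<subseteq> X \<times> X\<close>: its domain is \<open>Domain A\<close>
  and its range is \<open>Range A\<close>; the inverse is the converse relation.
\<close>

type_synonym ('n, 'm) op = "(('n, 'm) L2 \<times> ('n, 'm) L2) set"

definition operator_in :: "('n::finite, 'm::finite) L2 set \<Rightarrow> ('n, 'm) op \<Rightarrow> bool" where
  "operator_in X A \<longleftrightarrow>
     A \<subseteq> X \<times> X \<and> single_valued A \<and> (0, 0) \<in> A \<and>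
     (\<forall>u v u' v'. (u, v) \<in> A \<and> (u', v') \<in> A \<longrightarrow> (u + u', v + v') \<in> A) \<and>
     (\<forall>c u v. (u, v) \<in> A \<longrightarrow> (cscale c u, cscale c v) \<in> A)"

definition adjoint_op ::
    "('n::finite, 'm::finite) L2 set \<Rightarrow> ('n, 'm) op \<Rightarrow> ('n, 'm) op" where
  "adjoint_op X A =
     {(u, v). u \<in> X \<and> v \<in> X \<and> (\<forall>(x, y)\<in>A. cinner y u = cinner x v)}"

definition self_adjoint_in :: "('n::finite, 'm::finite) L2 set \<Rightarrow> ('n, 'm) op \<Rightarrow> bool" where
  "self_adjoint_in X A \<longleftrightarrow>
     operator_in X A \<and> X \<subseteq> closure (Domain A) \<and> adjoint_op X A = A"

definition bounded_operator_on ::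
    "('n::finite, 'm::finite) L2 set \<Rightarrow> (('n, 'm) L2 \<Rightarrow> ('n, 'm) L2) \<Rightarrow> bool" where
  "bounded_operator_on X K \<longleftrightarrow>
     (\<forall>u\<in>X. K u \<in> X) \<and>
     (\<forall>u\<in>X. \<forall>v\<in>X. K (u + v) = K u + K v) \<and>
     (\<forall>c. \<forall>u\<in>X. K (cscale c u) = cscale c (K u)) \<and>
     (\<exists>C. \<forall>u\<in>X. norm (K u) \<le> C * norm u)"

definition compact_operator_on ::
    "('n::finite, 'm::finite) L2 set \<Rightarrow> (('n, 'm) L2 \<Rightarrow> ('n, 'm) L2) \<Rightarrow> bool" where
  "compact_operator_on X K \<longleftrightarrow>
     bounded_operator_on X K \<and> (\<forall>S. S \<subseteq> X \<and> bounded S \<longrightarrow> compact (closure (K ` S)))"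

text \<open>The operator norm takes values in the extended reals; it is \<open>\<infinity>\<close> if \<open>K\<close> is unbounded on \<open>X\<close>.\<close>

definition op_norm ::
    "('n::finite, 'm::finite) L2 set \<Rightarrow> (('n, 'm) L2 \<Rightarrow> ('n, 'm) L2) \<Rightarrow> ereal" where
  "op_norm X K = (SUP u\<in>{u \<in> X. norm u \<le> 1}. ereal (norm (K u)))"

definition op_plus_bounded ::
    "('n::finite, 'm::finite) op \<Rightarrow> (('n, 'm) L2 \<Rightarrow> ('n, 'm) L2) \<Rightarrow> ('n, 'm) op" where
  "op_plus_bounded A K = {(u, v + K u) | u v. (u, v) \<in> A}"

definition op_times_bounded ::
    "('n::finite, 'm::finite) L2 set \<Rightarrow> ('n, 'm) op \<Rightarrow> (('n, 'm) L2 \<Rightarrow> ('n, 'm) L2) \<Rightarrow> ('n, 'm) op"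
  where
  "op_times_bounded X A K = {(u, v). u \<in> X \<and> (K u, v) \<in> A}"

text \<open>For \<open>A\<close> with range in \<open>X\<close>, the domain of \<open>op_restrict A X\<close> is \<open>Domain A \<inter> X\<close>.\<close>

definition op_restrict ::
    "('n::finite, 'm::finite) op \<Rightarrow> ('n, 'm) L2 set \<Rightarrow> ('n, 'm) op" where
  "op_restrict A X = A \<inter> X \<times> X"

text \<open>\<open>op_shift z A\<close> is \<open>z - A\<close>.\<close>

definition op_shift :: "complex \<Rightarrow> ('n::finite, 'm::finite) op \<Rightarrow> ('n, 'm) op" where
  "op_shift z A = {(u, cscale z u - v) | u v. (u, v) \<in> A}"

definition resolvent_set ::
    "('n::finite, 'm::finite) L2 set \<Rightarrow> ('n, 'm) op \<Rightarrow> complex set" where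
  "resolvent_set X A =
     {z. single_valued ((op_shift z A)\<inverse>) \<and> Domain ((op_shift z A)\<inverse>) = X \<and>
         (\<exists>C. \<forall>(f, u)\<in>(op_shift z A)\<inverse>. norm u \<le> C * norm f)}"

definition spectrum :: "('n::finite, 'm::finite) L2 set \<Rightarrow> ('n, 'm) op \<Rightarrow> complex set" where
  "spectrum X A = - resolvent_set X A"

definition resolvent ::
    "('n::finite, 'm::finite) op \<Rightarrow> complex \<Rightarrow> ('n, 'm) L2 \<Rightarrow> ('n, 'm) L2" where
  "resolvent A z f = (THE u. (u, f) \<in> op_shift z A)"

definition eigenvalues :: "('n::finite, 'm::finite) op \<Rightarrow> complex set" where
  "eigenvalues A = {z. \<exists>u. u \<noteq> 0 \<and> (u, cscale z u) \<in> A}"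

definition null_space :: "('n::finite, 'm::finite) op \<Rightarrow> ('n, 'm) L2 set" where
  "null_space A = {u. (u, 0) \<in> A}"

definition eigenvalue_index :: "('n::finite, 'm::finite) op \<Rightarrow> complex \<Rightarrow> nat" where
  "eigenvalue_index A z =
     (LEAST m. null_space (op_shift z A ^^ m) = null_space (op_shift z A ^^ (m + 1)))"

definition bilipschitz :: "('a::metric_space \<Rightarrow> 'a) \<Rightarrow> bool" where
  "bilipschitz \<rho> \<longleftrightarrow>
     (\<exists>L>0. \<forall>x y. dist x y / L \<le> dist (\<rho> x) (\<rho> y) \<and> dist (\<rho> x) (\<rho> y) \<le> L * dist x y)"

text \<open>
  The index type \<open>'n\<close> is unordered, so some coordinate \<open>k\<close> plays the role of the last one. The
  choice of \<open>k\<close> is immaterial, since \<open>\<rho>\<close> may be composed with a permutation of the coordinates.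
\<close>

definition weakly_lipschitz_domain :: "(real^'n) set \<Rightarrow> bool" where
  "weakly_lipschitz_domain \<Omega> \<longleftrightarrow>
     open \<Omega> \<and> bounded \<Omega> \<and>
     (\<forall>y\<in>frontier \<Omega>. \<exists>V \<rho>. \<exists>k::'n. open V \<and> y \<in> V \<and> bilipschitz \<rho> \<and>
        \<Omega> \<inter> V = \<rho> ` {x. x $ k > 0} \<inter> V \<and>
        - closure \<Omega> \<inter> V = \<rho> ` {x. x $ k < 0} \<inter> V \<and>
        frontier \<Omega> \<inter> V = \<rho> ` {x. x $ k = 0} \<inter> V)"

definition partial_deriv :: "'n \<Rightarrow> (real^'n \<Rightarrow> complex) \<Rightarrow> real^'n \<Rightarrow> complex" where
  "partial_deriv j f x = frechet_derivative f (at x) (axis j 1)"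

primrec Ck :: "nat \<Rightarrow> (real^'n \<Rightarrow> complex) \<Rightarrow> bool" where
  "Ck 0 f \<longleftrightarrow> continuous_on UNIV f"
| "Ck (Suc k) f \<longleftrightarrow> f differentiable_on UNIV \<and> (\<forall>j. Ck k (partial_deriv j f))"

definition test_function :: "(real^'n) set \<Rightarrow> (real^'n \<Rightarrow> complex) \<Rightarrow> bool" where
  "test_function U \<phi> \<longleftrightarrow>
     (\<forall>k. Ck k \<phi>) \<and> compact (closure {x. \<phi> x \<noteq> 0}) \<and> closure {x. \<phi> x \<noteq> 0} \<subseteq> U"

text \<open>
  \<open>D\<^sub>1 u = (\<Sum>j. A\<^sub>j \<partial>\<^sub>j u)\<close> in the sense of distributions on \<open>\<Omega>\<close>, for constant matrices \<open>A\<^sub>j\<close>.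
  For self-adjoint \<open>D\<^sub>1\<close> it follows by duality that the test functions belong to the domain.
\<close>

definition homogeneous_first_order ::
    "(real^'n) set \<Rightarrow> ('n::finite, 'm::finite) op \<Rightarrow> bool" where
  "homogeneous_first_order \<Omega> D1 \<longleftrightarrow>
     (\<exists>A :: 'n \<Rightarrow> complex^'m^'m. \<forall>(u, v)\<in>D1. \<forall>\<phi>. test_function \<Omega> \<phi> \<longrightarrow>
        (\<integral>x. \<phi> x *s rep_l2 v x \<partial>lebesgue_on \<Omega>) =
        - (\<integral>x. (\<Sum>j\<in>UNIV. partial_deriv j \<phi> x *s (A j *v rep_l2 u x)) \<partial>lebesgue_on \<Omega>))"

definition local_boundary_conditions ::
    "(real^'n) set \<Rightarrow> ('n::finite, 'm::finite) op \<Rightarrow> bool" where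
  "local_boundary_conditions \<Omega> D1 \<longleftrightarrow>
     (\<forall>\<eta> u. test_function UNIV \<eta> \<and> u \<in> Domain D1 \<longrightarrow> scalar_mult_op \<Omega> \<eta> u \<in> Domain D1)"

definition admissible_D :: "(real^'n) set \<Rightarrow> ('n::finite, 'm::finite) op \<Rightarrow> bool" where
  "admissible_D \<Omega> D \<longleftrightarrow>
     closed (Range D) \<and>
     (\<exists>D1 D0. D = op_plus_bounded D1 D0 \<and>
        bounded_operator_on (L2 \<Omega>) D0 \<and>
        self_adjoint_in (L2 \<Omega>) D1 \<and>
        homogeneous_first_order \<Omega> D1 \<and> local_boundary_conditions \<Omega> D1) \<and>
     (\<exists>z \<in> resolvent_set (Range D) (op_restrict D (Range D)).
        compact_operator_on (Range D) (resolvent (op_restrict D (Range D)) z))"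

definition L_infinity :: "(real^'n) set \<Rightarrow> (real^'n \<Rightarrow> complex^'m^'m) \<Rightarrow> bool" where
  "L_infinity \<Omega> B \<longleftrightarrow>
     B \<in> borel_measurable (lebesgue_on \<Omega>) \<and> (\<exists>C. AE x in lebesgue_on \<Omega>. norm (B x) \<le> C)"

definition strictly_accretive :: "(real^'n) set \<Rightarrow> (real^'n \<Rightarrow> complex^'m^'m) \<Rightarrow> bool" where
  "strictly_accretive \<Omega> B \<longleftrightarrow>
     (\<exists>\<beta>>0. AE x in lebesgue_on \<Omega>. \<forall>v. Re (hdot (B x *v v) v) \<ge> \<beta> * (norm v)\<^sup>2)"

definition accretivity_angle :: "(real^'n) set \<Rightarrow> (real^'n \<Rightarrow> complex^'m^'m) \<Rightarrow> real" where
  "accretivity_angle \<Omega> B =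
     real_of_ereal (esssup (lebesgue_on \<Omega>) (\<lambda>x. SUP v\<in>-{0}. ereal \<bar>Arg (hdot (B x *v v) v)\<bar>))"

definition op_DB ::
    "(real^'n) set \<Rightarrow> ('n::finite, 'm::finite) op \<Rightarrow> (real^'n \<Rightarrow> complex^'m^'m) \<Rightarrow> ('n, 'm) op" where
  "op_DB \<Omega> D B = op_times_bounded (L2 \<Omega>) D (matrix_mult_op \<Omega> B)"

definition op_T ::
    "(real^'n) set \<Rightarrow> ('n::finite, 'm::finite) op \<Rightarrow> (real^'n \<Rightarrow> complex^'m^'m) \<Rightarrow> ('n, 'm) op" where
  "op_T \<Omega> D B = op_restrict (op_DB \<Omega> D B) (Range D)"

definition S_open :: "real \<Rightarrow> real \<Rightarrow> complex set" where
  "S_open \<alpha> \<tau> = {z. \<bar>Im z\<bar> < \<bar>Re z\<bar> * tan \<alpha> + \<tau>}"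

definition S_closed :: "real \<Rightarrow> complex set" where
  "S_closed \<alpha> = {z. \<bar>Im z\<bar> \<le> \<bar>Re z\<bar> * tan \<alpha>}"

definition Sigma_plus :: "real \<Rightarrow> real \<Rightarrow> real \<Rightarrow> complex set" where
  "Sigma_plus a \<tau> \<mu> = {z. Re z > a \<and> \<bar>Im z\<bar> < \<tau> + \<bar>Re z\<bar> * tan \<mu>}"

definition Sigma_minus :: "real \<Rightarrow> real \<Rightarrow> real \<Rightarrow> complex set" where
  "Sigma_minus a \<tau> \<mu> = {z. - Re z > a \<and> \<bar>Im z\<bar> < \<tau> + \<bar>Re z\<bar> * tan \<mu>}"

definition Sigma_zero :: "nat \<Rightarrow> (nat \<Rightarrow> complex) \<Rightarrow> real \<Rightarrow> complex set" where
  "Sigma_zero N lam R = (\<Union>i\<in>{1..N}. ball (lam i) R)"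

definition Sigma_dom ::
    "nat \<Rightarrow> (nat \<Rightarrow> complex) \<Rightarrow> real \<Rightarrow> real \<Rightarrow> real \<Rightarrow> real \<Rightarrow> complex set" where
  "Sigma_dom N lam R a \<tau> \<mu> =
     Sigma_minus a \<tau> \<mu> \<union> Sigma_plus a \<tau> \<mu> \<union> Sigma_zero N lam R"

definition H_infinity :: "complex set \<Rightarrow> (complex \<Rightarrow> complex) set" where
  "H_infinity U = {h. h holomorphic_on U \<and> bounded (h ` U)}"

text \<open>The integral of \<open>F\<close> along the curve \<open>g\<close>, where \<open>g\<close> is parametrised by the interval \<open>I\<close>.\<close>

definition curve_integral ::
    "real set \<Rightarrow> (real \<Rightarrow> complex) \<Rightarrow> (complex \<Rightarrow> ('n::finite, 'm::finite) L2) \<Rightarrow> ('n, 'm) L2" where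
  "curve_integral I g F =
     integral I (\<lambda>t. cscale (vector_derivative g (at t within I)) (F (g t)))"

text \<open>
  For \<open>s = 1\<close>, the anti-clockwise boundary of \<open>{Re z > b, \<bar>Im z\<bar> < \<tau> + \<bar>Re z\<bar> tan \<nu>}\<close>: inwards
  along the upper ray, down the vertical segment, outwards along the lower ray. For \<open>s = -1\<close>, the
  image of this curve under the rotation \<open>z \<mapsto> - z\<close>.
\<close>

definition wedge_integral ::
    "complex \<Rightarrow> real \<Rightarrow> real \<Rightarrow> real \<Rightarrow> (complex \<Rightarrow> ('n::finite, 'm::finite) L2) \<Rightarrow> ('n, 'm) L2" where
  "wedge_integral s \<tau> \<nu> b F =
     curve_integral {..- b} (\<lambda>t. s * Complex (- t) (\<tau> - t * tan \<nu>)) F +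
     curve_integral {-(\<tau> + b * tan \<nu>)..\<tau> + b * tan \<nu>} (\<lambda>t. s * Complex b (- t)) F +
     curve_integral {b..} (\<lambda>t. s * Complex t (-(\<tau> + t * tan \<nu>))) F"

definition gamma_integral ::
    "nat \<Rightarrow> (nat \<Rightarrow> complex) \<Rightarrow> real \<Rightarrow> real \<Rightarrow> real \<Rightarrow> real \<Rightarrow>
     (complex \<Rightarrow> ('n::finite, 'm::finite) L2) \<Rightarrow> ('n, 'm) L2" where
  "gamma_integral N lam \<tau> r \<nu> b F =
     wedge_integral (-1) \<tau> \<nu> b F + wedge_integral 1 \<tau> \<nu> b F +
     (\<Sum>i\<in>{1..N}. curve_integral {0..1} (circlepath (lam i) r) F)"

text \<open>
  \<open>\<psi>(T) = 1/(2\<pi>\<i>) \<integral>\<^sub>\<gamma> \<psi>(\<zeta>) (\<zeta> - T)\<^sup>-\<^sup>1 d\<zeta>\<close>, evaluated pointwise on vectors \<open>u\<close> of the underlying space.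
\<close>

definition functional_calculus ::
    "nat \<Rightarrow> (nat \<Rightarrow> complex) \<Rightarrow> real \<Rightarrow> real \<Rightarrow> real \<Rightarrow> real \<Rightarrow>
     ('n::finite, 'm::finite) op \<Rightarrow> (complex \<Rightarrow> complex) \<Rightarrow> ('n, 'm) L2 \<Rightarrow> ('n, 'm) L2" where
  "functional_calculus N lam \<tau> r \<nu> b T \<psi> u =
     cscale (1 / (2 * of_real pi * \<i>))
       (gamma_integral N lam \<tau> r \<nu> b (\<lambda>z. cscale (\<psi> z) (resolvent T z u)))"

end

theory Submission
  imports Defs
begin

text \<open>
  As \<open>h\<close> vanishes off one disc, only the circle around \<open>\<lambda>\<^sub>i\<close> contributes to \<open>h(T)\<close>, so everything depends on the
  singularity of the resolvent at \<open>\<lambda>\<^sub>i\<close>. The claim is that \<open>(z - T)\<^sup>-\<^sup>1 = O(\<bar>z - \<lambda>\<^sub>i\<bar>\<^sup>-\<^sup>m)\<close> with \<open>m\<close> the index;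
  Cauchy's formula for higher derivatives and the Leibniz rule then express \<open>h(T)\<close> through
  \<open>h(\<lambda>\<^sub>i), \<dots>, h\<^sup>(\<^sup>m\<^sup>-\<^sup>1\<^sup>)(\<lambda>\<^sub>i)\<close>.

  For the growth bound, fix \<open>z\<^sub>0\<close> in the resolvent set. The operator \<open>K = (z\<^sub>0 - T)\<^sup>-\<^sup>1\<close> is compact, with
  eigenvalue \<open>\<kappa> = 1 / (z\<^sub>0 - \<lambda>\<^sub>i)\<close>, and \<open>N((\<lambda>\<^sub>i - T)\<^sup>k) = N((\<kappa> - K)\<^sup>k)\<close>. These spaces stabilize at \<open>k = m\<close>. Modulo
  \<open>N((\<kappa> - K)\<^sup>m)\<close>, the operator \<open>\<kappa> + \<sigma> - K\<close> is bounded below uniformly for small \<open>\<sigma>\<close>, by compactness; on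
  \<open>N((\<kappa> - K)\<^sup>m)\<close> it is a multiple of the identity plus a nilpotent operator and is bounded below by
  a multiple of \<open>\<bar>\<sigma>\<bar>\<^sup>m\<close>.
\<close>

subsection \<open>The Hilbert space structure of \<open>l2\<close>\<close>

text \<open>The obstacle is the origin of compactness. Only the resolvent of D on R(D) is assumed
  compact, while T = DB involves B, which need not map R(D) into itself. An inequality between norms
  bounds u by the images of u and T u under the resolvent of D. Applied to differences of a sequence
  it yields Cauchy subsequences, and their limits require \<open>l2\<close> to be complete.

  Near the eigenvalue, lower bounds for \<open>\<kappa> + \<sigma> - K\<close> are enough: for z in
  the resolvent set the solution exists anyway, so neither a Riesz projection nor a Laurent
  expansion is constructed. Complex analysis stays scalar as well. The vector v given by the contour
  integral is paired with v itself, so weak holomorphy of the resolvent and the scalar Cauchy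
  formula bound its norm squared.\<close>

lemma sq_integrable_rep_l2: "sq_integrable (rep_l2 u)"
  using Quotient3_rep_reflp[OF Quotient3_l2, of u] by (simp add: l2_rel_def)

lemma abs_rep_l2: "abs_l2 (rep_l2 u) = u"
  by (rule Quotient3_abs_rep[OF Quotient3_l2])

lemma abs_l2_eqI:
  assumes "sq_integrable f" "sq_integrable g" "AE x in lebesgue. f x = g x"
  shows "abs_l2 f = abs_l2 g"
  using Quotient3_rel_abs[OF Quotient3_l2, of f g] assms by (simp add: l2_rel_def)

lemma rep_abs_l2: "sq_integrable f \<Longrightarrow> AE x in lebesgue. rep_l2 (abs_l2 f) x = f x"
  using rep_abs_rsp_left[OF Quotient3_l2, of f f] by (simp add: l2_rel_def)

lemma l2_eqI: "(AE x in lebesgue. rep_l2 u x = rep_l2 v x) \<Longrightarrow> u = v"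
  by (metis abs_l2_eqI abs_rep_l2 sq_integrable_rep_l2)

lemma abs_l2_add:
  assumes "sq_integrable f" "sq_integrable g"
  shows "abs_l2 f + abs_l2 g = abs_l2 (\<lambda>x. f x + g x)"
  using assms by (intro plus_l2.abs_eq) (auto simp: l2_rel_def eq_onp_def)

lemma abs_l2_scaleR:
  assumes "sq_integrable f"
  shows "r *\<^sub>R abs_l2 f = abs_l2 (\<lambda>x. r *\<^sub>R f x)"
  using assms by (intro scaleR_l2.abs_eq) (auto simp: l2_rel_def eq_onp_def)

lemma rep_l2_add: "AE x in lebesgue. rep_l2 (u + v) x = rep_l2 u x + rep_l2 v x"
  using rep_abs_l2[OF sq_integrable_add[OF sq_integrable_rep_l2[of u] sq_integrable_rep_l2[of v]]]
  by (simp add: abs_l2_add[symmetric] sq_integrable_rep_l2 abs_rep_l2)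

lemma rep_l2_scaleR: "AE x in lebesgue. rep_l2 (r *\<^sub>R u) x = r *\<^sub>R rep_l2 u x"
  using rep_abs_l2[OF sq_integrable_scaleR[OF sq_integrable_rep_l2[of u], of r]]
  by (simp add: abs_l2_scaleR[symmetric] sq_integrable_rep_l2 abs_rep_l2)

lemma rep_l2_diff: "AE x in lebesgue. rep_l2 (u - v) x = rep_l2 u x - rep_l2 v x"
  using rep_l2_add[of u "(-1) *\<^sub>R v"] rep_l2_scaleR[of "-1" v] by eventually_elim simp

lemma inner_l2_rep: "inner u v = (\<integral>x. rep_l2 u x \<bullet> rep_l2 v x \<partial>lebesgue)"
  by (simp add: inner_l2.rep_eq)

lemma norm_l2_rep: "(norm u)\<^sup>2 = (\<integral>x. (norm (rep_l2 u x))\<^sup>2 \<partial>lebesgue)"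
  by (simp add: power2_norm_eq_inner inner_l2_rep)

section \<open>Completeness of the space \<open>l2\<close>\<close>

lemma nn_integral_l2_rep: "(\<integral>\<^sup>+x. ennreal ((norm (rep_l2 u x))\<^sup>2) \<partial>lebesgue) = ennreal ((norm u)\<^sup>2)"
  using sq_integrable_rep_l2[of u] unfolding norm_l2_rep sq_integrable_def
  by (intro nn_integral_eq_integral) auto

lemma sets_l2_large: "{x. norm (rep_l2 u x) \<ge> c} \<in> sets lebesgue"
proof -
  have [measurable]: "rep_l2 u \<in> borel_measurable lebesgue"
    using sq_integrable_rep_l2[of u] by (simp add: sq_integrable_def)
  have "{x \<in> space lebesgue. norm (rep_l2 u x) \<ge> c} \<in> sets lebesgue"
    by measurable
  then show ?thesis by simp
qed

text \<open>Chebyshev's inequality for the square of the norm; it feeds norm decay into the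
  Borel-Cantelli lemma.\<close>

lemma emeasure_l2_large:
  assumes "c > 0"
  shows "emeasure lebesgue {x. norm (rep_l2 u x) \<ge> c} \<le> ennreal ((norm u / c)\<^sup>2)"
proof -
  have [measurable]: "rep_l2 u \<in> borel_measurable lebesgue"
    using sq_integrable_rep_l2[of u] by (simp add: sq_integrable_def)
  have "emeasure lebesgue {x. norm (rep_l2 u x) \<ge> c} =
      (\<integral>\<^sup>+x. indicator {x. norm (rep_l2 u x) \<ge> c} x \<partial>lebesgue)"
    by (rule nn_integral_indicator[symmetric]) (rule sets_l2_large)
  also have "\<dots> \<le> (\<integral>\<^sup>+x. ennreal (1 / c\<^sup>2) * ennreal ((norm (rep_l2 u x))\<^sup>2) \<partial>lebesgue)"
  proof (rule nn_integral_mono)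
    fix x
    have "1 \<le> ennreal (1 / c\<^sup>2) * ennreal ((norm (rep_l2 u x))\<^sup>2)" if "norm (rep_l2 u x) \<ge> c"
    proof -
      have "1 \<le> (1 / c\<^sup>2) * (norm (rep_l2 u x))\<^sup>2"
        using assms power_mono[OF that, of 2] by (simp add: field_simps)
      then show ?thesis
        by (subst ennreal_mult''[symmetric]) (auto simp: ennreal_1[symmetric] simp del: ennreal_1 intro: ennreal_leI)
    qed
    then show "indicator {x. norm (rep_l2 u x) \<ge> c} x \<le> ennreal (1 / c\<^sup>2) * ennreal ((norm (rep_l2 u x))\<^sup>2)"
      by (auto simp: indicator_def)
  qed
  also have "\<dots> = ennreal (1 / c\<^sup>2) * ennreal ((norm u)\<^sup>2)"
    by (subst nn_integral_cmult) (simp_all add: nn_integral_l2_rep)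
  also have "\<dots> = ennreal ((norm u / c)\<^sup>2)"
    by (simp add: ennreal_mult'' [symmetric] power_divide)
  finally show ?thesis .
qed

text \<open>The set where the k-th increment reaches 2^-k has measure at most 2^-k, so by
  Borel-Cantelli almost every point lies in only finitely many of these sets. At such a point the
  increments are eventually dominated by a geometric series. The rate (1/4)^k leaves room for both
  the pointwise threshold and the summable measures.\<close>

lemma l2_fast_Cauchy_AE:
  fixes X :: "nat \<Rightarrow> ('a::euclidean_space, 'b::euclidean_space) l2"
  assumes "\<And>k. norm (X (Suc k) - X k) \<le> (1/4) ^ k"
  shows "AE x in lebesgue. convergent (\<lambda>k. rep_l2 (X k) x)"
proof -
  define A where "A k = {x. norm (rep_l2 (X (Suc k) - X k) x) \<ge> (1/2) ^ k}" for k
  have [measurable]: "rep_l2 u \<in> borel_measurable lebesgue" for u :: "('a, 'b) l2"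
    using sq_integrable_rep_l2[of u] by (simp add: sq_integrable_def)
  have A: "A k \<in> sets lebesgue" for k unfolding A_def by (rule sets_l2_large)
  have e: "emeasure lebesgue (A k) \<le> ennreal ((1/2) ^ k)" for k
  proof -
    have "emeasure lebesgue (A k) \<le> ennreal ((norm (X (Suc k) - X k) / (1/2)^k)\<^sup>2)"
      unfolding A_def by (rule emeasure_l2_large) simp
    also have "\<dots> \<le> ennreal ((1/2) ^ k)"
    proof (rule ennreal_leI)
      have "norm (X (Suc k) - X k) / (1/2)^k \<le> (1/4)^k / (1/2)^k"
        using assms[of k] by (intro divide_right_mono) auto
      also have "\<dots> = (1/2)^k" by (simp add: power_divide[symmetric])
      finally have "(norm (X (Suc k) - X k) / (1/2)^k)\<^sup>2 \<le> ((1/2)^k)\<^sup>2"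
        by (intro power_mono) auto
      also have "\<dots> = (1/2)^k * (1/2)^k" by (simp add: power2_eq_square)
      also have "\<dots> \<le> 1 * (1/2)^k"
        by (intro mult_right_mono power_le_one) auto
      finally show "(norm (X (Suc k) - X k) / (1/2)^k)\<^sup>2 \<le> (1/2)^k" by simp
    qed
    finally show ?thesis .
  qed
  have "AE x in lebesgue. eventually (\<lambda>k. x \<in> space lebesgue - A k) sequentially"
  proof (rule borel_cantelli_AE1[OF A])
    show "emeasure lebesgue (A k) < \<infinity>" for k
      using e[of k] by (simp add: order_le_less_trans)
    have "measure lebesgue (A k) \<le> (1/2)^k" for k
      using e[of k] by (simp add: measure_def enn2real_leI)
    then show "summable (\<lambda>k. measure lebesgue (A k))"
      by (auto intro!: summable_comparison_test'[OF summable_geometric[of "1/2::real"], of 0])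
  qed
  moreover have "AE x in lebesgue. \<forall>k. rep_l2 (X (Suc k) - X k) x = rep_l2 (X (Suc k)) x - rep_l2 (X k) x"
    by (subst AE_all_countable) (auto intro: rep_l2_diff)
  ultimately show ?thesis
  proof eventually_elim
    case (elim x)
    then have "eventually (\<lambda>k. norm (rep_l2 (X (Suc k)) x - rep_l2 (X k) x) \<le> (1/2)^k) sequentially"
      by (auto simp: A_def elim!: eventually_mono)
    then have "summable (\<lambda>k. rep_l2 (X (Suc k)) x - rep_l2 (X k) x)"
      by (rule summable_comparison_test_ev[OF _ summable_geometric]) auto
    then show ?case by (simp add: summable_iff_convergent sum_lessThan_telescope[of "\<lambda>k. rep_l2 (X k) x"]
        convergent_diff_const_right_iff)
  qed
qed

text \<open>The pointwise limit is the candidate. Fatou's lemma, with the second index going to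
  infinity, bounds its distance to \<open>X n\<close>; this also shows that it is square integrable,
  being the sum of such a difference and some \<open>X N\<close>.\<close>

lemma l2_fast_Cauchy_convergent:
  fixes X :: "nat \<Rightarrow> ('a::euclidean_space, 'b::euclidean_space) l2"
  assumes "\<And>k. norm (X (Suc k) - X k) \<le> (1/4) ^ k" and "Cauchy X"
  shows "convergent X"
proof -
  \<comment> \<open>\<open>lim\<close> also has a value where the sequence diverges; this happens
    only on a null set, and \<open>f\<close> is measurable all the same.\<close>
  define f where "f x = lim (\<lambda>k. rep_l2 (X k) x)" for x
  have [measurable]: "rep_l2 u \<in> borel_measurable lebesgue" for u :: "('a, 'b) l2"
    using sq_integrable_rep_l2[of u] by (simp add: sq_integrable_def)
  have [measurable]: "f \<in> borel_measurable lebesgue"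
    unfolding f_def by measurable
  have lim: "AE x in lebesgue. (\<lambda>k. rep_l2 (X k) x) \<longlonglongrightarrow> f x"
    using l2_fast_Cauchy_AE[OF assms(1)] by eventually_elim (simp add: f_def convergent_LIMSEQ_iff)
  have bd: "(\<integral>\<^sup>+x. ennreal ((norm (f x - rep_l2 (X n) x))\<^sup>2) \<partial>lebesgue) \<le> ennreal (e\<^sup>2)"
    if "e > 0" and N: "\<And>j. j \<ge> n \<Longrightarrow> norm (X j - X n) \<le> e" for e n
  proof -
    have "(\<integral>\<^sup>+x. ennreal ((norm (f x - rep_l2 (X n) x))\<^sup>2) \<partial>lebesgue) \<le>
        (\<integral>\<^sup>+x. liminf (\<lambda>j. ennreal ((norm (rep_l2 (X j) x - rep_l2 (X n) x))\<^sup>2)) \<partial>lebesgue)"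
    proof (rule nn_integral_mono_AE, use lim in eventually_elim)
      case (elim x)
      then have "(\<lambda>j. ennreal ((norm (rep_l2 (X j) x - rep_l2 (X n) x))\<^sup>2)) \<longlonglongrightarrow>
          ennreal ((norm (f x - rep_l2 (X n) x))\<^sup>2)"
        by (intro tendsto_intros)
      from lim_imp_Liminf[OF _ this] show ?case by simp
    qed
    also have "\<dots> \<le> liminf (\<lambda>j. \<integral>\<^sup>+x. ennreal ((norm (rep_l2 (X j) x - rep_l2 (X n) x))\<^sup>2) \<partial>lebesgue)"
      by (rule nn_integral_liminf) measurable
    also have "\<dots> = liminf (\<lambda>j. ennreal ((norm (X j - X n))\<^sup>2))"
    proof -
      have "(\<integral>\<^sup>+x. ennreal ((norm (rep_l2 (X j) x - rep_l2 (X n) x))\<^sup>2) \<partial>lebesgue) =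
          (\<integral>\<^sup>+x. ennreal ((norm (rep_l2 (X j - X n) x))\<^sup>2) \<partial>lebesgue)" for j
        by (rule nn_integral_cong_AE, use rep_l2_diff[of "X j" "X n"] in eventually_elim) simp
      then show ?thesis by (simp add: nn_integral_l2_rep)
    qed
    also have "\<dots> \<le> liminf (\<lambda>j. ennreal (e\<^sup>2))"
      using N by (intro Liminf_mono eventually_sequentiallyI[of n] ennreal_leI power_mono) auto
    also have "\<dots> = ennreal (e\<^sup>2)" by (simp add: Liminf_const)
    finally show ?thesis .
  qed
  have near: "\<exists>N. \<forall>n\<ge>N. (\<integral>\<^sup>+x. ennreal ((norm (f x - rep_l2 (X n) x))\<^sup>2) \<partial>lebesgue) \<le> ennreal (e\<^sup>2)"
    if "e > 0" for e
  proof -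
    obtain N where N: "\<And>m n. m \<ge> N \<Longrightarrow> n \<ge> N \<Longrightarrow> norm (X m - X n) < e"
      using CauchyD[OF assms(2) \<open>e > 0\<close>] by blast
    then show ?thesis
      using bd[OF \<open>e > 0\<close>] by (meson less_imp_le order_trans)
  qed
  have diff: "sq_integrable (\<lambda>x. f x - rep_l2 (X n) x)"
    if "(\<integral>\<^sup>+x. ennreal ((norm (f x - rep_l2 (X n) x))\<^sup>2) \<partial>lebesgue) \<le> ennreal (e\<^sup>2)" for n e
  proof -
    have "(\<integral>\<^sup>+x. ennreal (norm ((norm (f x - rep_l2 (X n) x))\<^sup>2)) \<partial>lebesgue) < \<infinity>"
      using that by (simp add: order_le_less_trans)
    then show ?thesis
      unfolding sq_integrable_def by (intro conjI integrableI_bounded) measurable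
  qed
  obtain N where N: "\<And>n. n \<ge> N \<Longrightarrow> (\<integral>\<^sup>+x. ennreal ((norm (f x - rep_l2 (X n) x))\<^sup>2) \<partial>lebesgue) \<le> ennreal (1\<^sup>2)"
    using near[of 1] by auto
  have f: "sq_integrable f"
    using sq_integrable_add[OF diff[OF N[of N]] sq_integrable_rep_l2[of "X N"]] by simp
  have "X \<longlonglongrightarrow> abs_l2 f"
  proof (rule LIMSEQ_I)
    fix r :: real assume "r > 0"
    then obtain M where M: "\<And>n. n \<ge> M \<Longrightarrow>
        (\<integral>\<^sup>+x. ennreal ((norm (f x - rep_l2 (X n) x))\<^sup>2) \<partial>lebesgue) \<le> ennreal ((r/2)\<^sup>2)"
      using near[of "r/2"] by auto
    have "norm (X n - abs_l2 f) < r" if "n \<ge> M" for n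
    proof -
      have "ennreal ((norm (abs_l2 f - X n))\<^sup>2) =
          (\<integral>\<^sup>+x. ennreal ((norm (f x - rep_l2 (X n) x))\<^sup>2) \<partial>lebesgue)"
        unfolding nn_integral_l2_rep[symmetric]
        by (rule nn_integral_cong_AE,
            use rep_l2_diff[of "abs_l2 f" "X n"] rep_abs_l2[OF f] in eventually_elim) simp
      also have "\<dots> \<le> ennreal ((r/2)\<^sup>2)" by (rule M[OF that])
      finally have "(norm (abs_l2 f - X n))\<^sup>2 \<le> (r/2)\<^sup>2" by simp
      then have "norm (abs_l2 f - X n) \<le> r/2"
        using \<open>r > 0\<close> by (auto intro: power2_le_imp_le)
      then show ?thesis using \<open>r > 0\<close> by (simp add: norm_minus_commute)
    qed
    then show "\<exists>M. \<forall>n\<ge>M. norm (X n - abs_l2 f) < r" by blast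
  qed
  then show ?thesis by (auto simp: convergent_def)
qed

text \<open>Used in \<open>compact_resolvent\<close>, where a subsequence is shown to be Cauchy
  before any limit is known.\<close>

instance l2 :: (euclidean_space, euclidean_space) complete_space
proof
  fix X :: "nat \<Rightarrow> ('a, 'b) l2"
  assume X: "Cauchy X"
  have "\<exists>N. \<forall>m\<ge>N. \<forall>n\<ge>N. norm (X m - X n) < (1/4)^k" for k
    using CauchyD[OF X, of "(1/4)^k"] by simp
  then obtain N where N: "\<And>k m n. m \<ge> N k \<Longrightarrow> n \<ge> N k \<Longrightarrow> norm (X m - X n) < (1/4)^k"
    by metis
  \<comment> \<open>\<open>Suc p\<close> keeps the indices strictly increasing, and
    \<open>N (Suc k)\<close> enforces the rate of convergence.\<close>
  define s where "s = rec_nat (N 0) (\<lambda>k p. max (Suc p) (N (Suc k)))"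
  have s0: "s 0 = N 0" and sS: "s (Suc k) = max (Suc (s k)) (N (Suc k))" for k
    by (simp_all add: s_def)
  have mono: "strict_mono s"
    unfolding strict_mono_Suc_iff using sS by (simp add: less_max_iff_disj)
  have ge: "s k \<ge> N k" for k
    by (cases k) (simp_all add: s0 sS)
  have "norm ((X \<circ> s) (Suc k) - (X \<circ> s) k) \<le> (1/4)^k" for k
    using N[of k "s (Suc k)" "s k"] ge[of k] mono
    by (simp add: strict_mono_less_eq less_imp_le order_trans[OF ge[of k]])
  moreover have "Cauchy (X \<circ> s)"
    by (rule Cauchy_subseq_Cauchy[OF X mono])
  ultimately have "convergent (X \<circ> s)"
    by (rule l2_fast_Cauchy_convergent)
  then obtain L where "(X \<circ> s) \<longlonglongrightarrow> L" by (auto simp: convergent_def)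
  then have "X \<longlonglongrightarrow> L" by (rule Cauchy_converges_subseq[OF X mono])
  then show "convergent X" by (auto simp: convergent_def)
qed

section \<open>Complex scalars and the complex inner product on \<open>l2\<close>\<close>

lemma norm_vec_smult: "norm (c *s v) = cmod c * norm (v :: complex^'m)"
proof -
  have "norm (c *s v) = L2_set (\<lambda>i. cmod c * norm (v $ i)) UNIV"
    by (simp add: norm_vec_def norm_mult)
  then show ?thesis by (simp add: L2_set_right_distrib norm_vec_def)
qed

lemma bounded_linear_vec_smult: "bounded_linear (\<lambda>v :: complex^'m. c *s v)"
  by (rule bounded_linear_intro[where K = "cmod c"])
    (auto simp: vec_eq_iff norm_vec_smult algebra_simps)

lemma sq_integrable_smult:
  fixes f :: "'a::euclidean_space \<Rightarrow> complex^'m"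
  assumes "sq_integrable f"
  shows "sq_integrable (\<lambda>x. c *s f x)"
proof -
  have "(\<lambda>x. c *s f x) \<in> borel_measurable lebesgue"
    using assms linear_continuous_on[OF bounded_linear_vec_smult, of UNIV c]
    unfolding sq_integrable_def by (auto intro: borel_measurable_continuous_on)
  then show ?thesis
    using assms by (auto simp: sq_integrable_def norm_vec_smult power_mult_distrib)
qed

lemma rep_cscale: "AE x in lebesgue. rep_l2 (cscale c u) x = c *s rep_l2 u x"
  unfolding cscale_def by (rule rep_abs_l2[OF sq_integrable_smult[OF sq_integrable_rep_l2]])

lemma cscale_add_right: "cscale c (u + v) = cscale c u + cscale c v"
  by (rule l2_eqI, use rep_cscale[of c "u + v"] rep_cscale[of c u] rep_cscale[of c v]
      rep_l2_add[of u v] rep_l2_add[of "cscale c u" "cscale c v"] in eventually_elim)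
    (simp add: vec_eq_iff algebra_simps)

lemma cscale_add_left: "cscale (c + d) u = cscale c u + cscale d u"
  by (rule l2_eqI, use rep_cscale[of "c + d" u] rep_cscale[of c u] rep_cscale[of d u]
      rep_l2_add[of "cscale c u" "cscale d u"] in eventually_elim)
    (simp add: vec_eq_iff algebra_simps)

lemma cscale_cscale [simp]: "cscale c (cscale d u) = cscale (c * d) u"
  by (rule l2_eqI, use rep_cscale[of c "cscale d u"] rep_cscale[of d u] rep_cscale[of "c * d" u]
      in eventually_elim) (simp add: vec_eq_iff algebra_simps)

lemma cscale_of_real: "cscale (of_real r) u = r *\<^sub>R u"
  by (rule l2_eqI, use rep_cscale[of "of_real r" u] rep_l2_scaleR[of r u] in eventually_elim)
    (simp add: vec_eq_iff complex_eq_iff)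

lemma cscale_simps [simp]:
  "cscale 1 u = u" "cscale 0 u = 0" "cscale c 0 = 0"
  "cscale (- 1) u = - u" "cscale c (- u) = - cscale c u" "cscale (- c) u = - cscale c u"
proof -
  show "cscale 1 u = u" "cscale 0 u = 0" "cscale (- 1) u = - u"
    using cscale_of_real[of 1 u] cscale_of_real[of 0 u] cscale_of_real[of "- 1" u] by simp_all
  show 0: "cscale c 0 = 0"
    using cscale_add_right[of c 0 0] by simp
  show "cscale c (- u) = - cscale c u"
    using cscale_add_right[of c u "- u"] by (simp add: 0 eq_neg_iff_add_eq_0 add.commute)
  show "cscale (- c) u = - cscale c u"
    using cscale_cscale[of c "- 1" u] cscale_add_left[of c "- c" u] \<open>cscale 0 u = 0\<close>
    by (simp add: eq_neg_iff_add_eq_0 add.commute)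
qed

lemma cscale_diff_right: "cscale c (u - v) = cscale c u - cscale c v"
  using cscale_add_right[of c u "- v"] by simp

lemma cscale_diff_left: "cscale (c - d) u = cscale c u - cscale d u"
  using cscale_add_left[of c "- d" u] by simp

lemma cscale_scaleR: "cscale c (r *\<^sub>R u) = r *\<^sub>R cscale c u"
  by (simp add: cscale_of_real[symmetric] mult.commute)

lemma norm_cscale [simp]: "norm (cscale c u) = cmod c * norm u"
proof -
  have "(norm (cscale c u))\<^sup>2 = (\<integral>x. (cmod c)\<^sup>2 * (norm (rep_l2 u x))\<^sup>2 \<partial>lebesgue)"
    unfolding norm_l2_rep
  proof (rule integral_cong_AE)
    show "AE x in lebesgue. (norm (rep_l2 (cscale c u) x))\<^sup>2 = (cmod c)\<^sup>2 * (norm (rep_l2 u x))\<^sup>2"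
      using rep_cscale[of c u] by eventually_elim (simp add: norm_vec_smult power_mult_distrib)
  qed (use sq_integrable_rep_l2[of u] sq_integrable_rep_l2[of "cscale c u"] in \<open>auto simp: sq_integrable_def\<close>)
  also have "\<dots> = (cmod c * norm u)\<^sup>2"
    by (simp add: norm_l2_rep power_mult_distrib)
  finally show ?thesis
    by (simp add: power2_eq_iff_nonneg)
qed

lemma bounded_linear_cscale: "bounded_linear (cscale c)"
  by (rule bounded_linear_intro[where K = "cmod c"])
    (auto simp: cscale_add_right cscale_scaleR mult.commute)

text \<open>The real inner product is the real part of \<open>hdot\<close>, and the imaginary part
  is recovered by rotating the first argument by \<i>. In this way facts about the complex product
  reduce to \<open>real_inner\<close>.\<close>

lemma hdot_eq: "hdot v w = of_real (inner v w) - \<i> * of_real (inner (\<i> *s v) w)"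
proof -
  have "z * cnj w = of_real (inner z w) - \<i> * of_real (inner (\<i> * z) w)" for z w
    by (simp add: complex_eq_iff inner_complex_def algebra_simps)
  then show ?thesis
    by (simp add: hdot_def inner_vec_def sum_subtractf sum_distrib_left)
qed

lemma Re_hdot: "Re (hdot v w) = inner v w"
  by (simp add: hdot_eq)

lemma cinner_eq: "cinner u v = Complex (inner u v) (- inner (cscale \<i> u) v)"
proof -
  have i: "integrable lebesgue (\<lambda>x. rep_l2 u x \<bullet> rep_l2 v x)" for u v :: "('n::finite, 'm::finite) L2"
    by (intro integrable_inner sq_integrable_rep_l2)
  have "cinner u v = (\<integral>x. of_real (rep_l2 u x \<bullet> rep_l2 v x) -
      \<i> * of_real (rep_l2 (cscale \<i> u) x \<bullet> rep_l2 v x) \<partial>lebesgue)"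
    unfolding cinner_def
  proof (rule integral_cong_AE)
    have *: "(\<lambda>x. rep_l2 u x \<bullet> rep_l2 v x) \<in> borel_measurable lebesgue"
      "(\<lambda>x. (\<i> *s rep_l2 u x) \<bullet> rep_l2 v x) \<in> borel_measurable lebesgue"
      using i[of u v] integrable_inner[OF sq_integrable_smult[OF sq_integrable_rep_l2] sq_integrable_rep_l2]
      by auto
    show "(\<lambda>x. hdot (rep_l2 u x) (rep_l2 v x)) \<in> borel_measurable lebesgue"
      unfolding hdot_eq using * by (intro borel_measurable_diff borel_measurable_times) auto
    show "(\<lambda>x. complex_of_real (rep_l2 u x \<bullet> rep_l2 v x) -
        \<i> * of_real (rep_l2 (cscale \<i> u) x \<bullet> rep_l2 v x)) \<in> borel_measurable lebesgue"
      using i[of u v] i[of "cscale \<i> u" v] by (intro borel_measurable_diff borel_measurable_times) auto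
    show "AE x in lebesgue. hdot (rep_l2 u x) (rep_l2 v x) = of_real (rep_l2 u x \<bullet> rep_l2 v x) -
        \<i> * of_real (rep_l2 (cscale \<i> u) x \<bullet> rep_l2 v x)"
      using rep_cscale[of \<i> u] by eventually_elim (simp add: hdot_eq)
  qed
  also have "\<dots> = of_real (inner u v) - \<i> * of_real (inner (cscale \<i> u) v)"
    using i[of u v] i[of "cscale \<i> u" v]
    by (subst Bochner_Integration.integral_diff) (auto simp: inner_l2_rep)
  finally show ?thesis by (simp add: complex_eq_iff)
qed

lemma cinner_cscale_left: "cinner (cscale c v) w = c * cinner v w"
proof -
  have c: "cscale c v = Re c *\<^sub>R v + Im c *\<^sub>R cscale \<i> v"
    using cscale_add_left[of "of_real (Re c)" "\<i> * of_real (Im c)" v]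
    by (simp add: complex_eq[symmetric] cscale_of_real[symmetric] mult.commute)
  have ic: "cscale (\<i> * c) v = Re c *\<^sub>R cscale \<i> v - Im c *\<^sub>R v"
    using cscale_cscale[of \<i> c v] unfolding c
    by (simp add: cscale_add_right cscale_scaleR)
  show ?thesis
    by (simp add: cinner_eq complex_eq_iff ic) (simp add: c inner_add_left inner_diff_left algebra_simps)
qed

text \<open>Cauchy-Schwarz is applied to the real and imaginary parts separately. The resulting
  factor 2 is harmless, since only the existence of constants matters.\<close>

lemma norm_cinner_le: "cmod (cinner v w) \<le> 2 * norm w * norm v"
  using cmod_le[of "cinner v w"] Cauchy_Schwarz_ineq2[of v w]
    Cauchy_Schwarz_ineq2[of "cscale \<i> v" w]
  by (simp add: cinner_eq mult.commute)

lemma bounded_linear_cinner_left: "bounded_linear (\<lambda>v. cinner v w)"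
proof (rule bounded_linear_intro[where K = "2 * norm w"])
  show "cmod (cinner v w) \<le> norm v * (2 * norm w)" for v
    using norm_cinner_le[of v w] by (simp add: mult.commute)
  show "cinner (r *\<^sub>R v) w = r *\<^sub>R cinner v w" for r v
    by (simp add: cscale_of_real[symmetric] cinner_cscale_left scaleR_conv_of_real)
qed (simp add: cinner_eq cscale_add_right inner_add_left complex_eq_iff)

lemma norm_le_cinner: "(norm v)\<^sup>2 \<le> cmod (cinner v v)"
  using complex_Re_le_cmod[of "cinner v v"] by (simp add: cinner_eq power2_norm_eq_inner)

subsection \<open>Compact operators near an eigenvalue\<close>

text \<open>The type \<open>l2\<close> is only a real vector space, so stability under complex
  scalars has to be demanded through \<open>cscale\<close>.\<close>

definition csubspace :: "('n::finite, 'm::finite) L2 set \<Rightarrow> bool" where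
  "csubspace X \<longleftrightarrow> 0 \<in> X \<and> (\<forall>u\<in>X. \<forall>v\<in>X. u + v \<in> X) \<and> (\<forall>c. \<forall>u\<in>X. cscale c u \<in> X)"

lemma csubspaceD:
  assumes "csubspace X"
  shows "0 \<in> X" "u \<in> X \<Longrightarrow> v \<in> X \<Longrightarrow> u + v \<in> X" "u \<in> X \<Longrightarrow> cscale c u \<in> X"
    "u \<in> X \<Longrightarrow> v \<in> X \<Longrightarrow> u - v \<in> X" "u \<in> X \<Longrightarrow> r *\<^sub>R u \<in> X"
proof -
  show "0 \<in> X" using assms by (simp add: csubspace_def)
  show add: "u \<in> X \<Longrightarrow> v \<in> X \<Longrightarrow> u + v \<in> X" for u v
    using assms by (simp add: csubspace_def)
  show cs: "u \<in> X \<Longrightarrow> cscale c u \<in> X" for c u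
    using assms by (simp add: csubspace_def)
  show "u \<in> X \<Longrightarrow> v \<in> X \<Longrightarrow> u - v \<in> X"
    using add[of u "- v"] cs[of v "- 1"] by simp
  show "u \<in> X \<Longrightarrow> r *\<^sub>R u \<in> X"
    using cs[of u "of_real r"] by (simp add: cscale_of_real)
qed

text \<open>Riesz's lemma. If z has distance d > 0 from the closed space Y and \<open>y0\<close> in
  Y is closer than 2 d to z, then normalizing \<open>z - y0\<close> gives a unit vector at distance
  at least d / (2 d) from Y.\<close>

lemma riesz_almost_orthogonal:
  assumes "csubspace Y" "closed Y" "csubspace Z" "Y \<subset> Z"
  obtains u where "u \<in> Z" "norm u = 1" "\<And>y. y \<in> Y \<Longrightarrow> norm (u - y) \<ge> 1/2"
proof -
  note Y = csubspaceD[OF assms(1)] and Z = csubspaceD[OF assms(3)]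
  obtain z where z: "z \<in> Z" "z \<notin> Y" using assms(4) by blast
  define d where "d = infdist z Y"
  have ne: "Y \<noteq> {}" using Y(1) by blast
  have "d > 0"
    using z ne assms(2) in_closed_iff_infdist_zero[of Y z] infdist_nonneg[of z Y]
    by (auto simp: d_def order_less_le)
  then obtain y0 where y0: "y0 \<in> Y" "dist z y0 < 2 * d"
    using cInf_lessD[of "dist z ` Y" "2 * d"] ne by (auto simp: d_def infdist_def)
  define w where "w = z - y0"
  have w: "w \<in> Z" "norm w < 2 * d" "norm w > 0"
    using z y0 assms(4) Z(4) by (auto simp: w_def dist_norm)
  show ?thesis
  proof
    show "(1 / norm w) *\<^sub>R w \<in> Z" using w Z(5) by blast
    show "norm ((1 / norm w) *\<^sub>R w) = 1" using w by simp
    fix y assume y: "y \<in> Y"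
    have "d \<le> norm (z - (y0 + norm w *\<^sub>R y))"
      using infdist_le[of "y0 + norm w *\<^sub>R y" Y z] y y0 Y(2,5) by (auto simp: d_def dist_norm)
    also have "z - (y0 + norm w *\<^sub>R y) = norm w *\<^sub>R ((1 / norm w) *\<^sub>R w - y)"
      using w by (simp add: w_def algebra_simps)
    finally have "d \<le> norm w * norm ((1 / norm w) *\<^sub>R w - y)" by simp
    then have "norm w * (1/2) \<le> norm w * norm ((1 / norm w) *\<^sub>R w - y)"
      using w(2) by simp
    then show "norm ((1 / norm w) *\<^sub>R w - y) \<ge> 1/2" using w(3) by (simp only: mult_le_cancel_left_pos)
  qed
qed

text \<open>\<open>K\<close> is a total function, but only its restriction to \<open>H\<close> is
  meaningful, hence the membership conditions throughout. Compactness has the sequential form in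
  which all later arguments consume it.\<close>

locale compact_perturbation =
  fixes H :: "('n::finite, 'm::finite) L2 set" and K :: "('n, 'm) L2 \<Rightarrow> ('n, 'm) L2" and \<kappa> :: complex
  assumes H: "csubspace H" and closed_H: "closed H"
    and K: "bounded_operator_on H K"
    and compact_K: "\<And>f :: nat \<Rightarrow> ('n, 'm) L2. range f \<subseteq> H \<Longrightarrow> bounded (range f) \<Longrightarrow>
      \<exists>s l. strict_mono s \<and> (\<lambda>k. K (f (s k))) \<longlonglongrightarrow> l"
    and \<kappa>: "\<kappa> \<noteq> 0"
begin

definition E :: "('n, 'm) L2 \<Rightarrow> ('n, 'm) L2" where
  "E u = cscale \<kappa> u - K u"

definition gker :: "nat \<Rightarrow> ('n, 'm) L2 set" where
  "gker k = {u \<in> H. (E ^^ k) u = 0}"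

lemmas HD = csubspaceD[OF H]

lemma K_in: "u \<in> H \<Longrightarrow> K u \<in> H"
  and K_add: "u \<in> H \<Longrightarrow> v \<in> H \<Longrightarrow> K (u + v) = K u + K v"
  and K_cscale: "u \<in> H \<Longrightarrow> K (cscale c u) = cscale c (K u)"
  using K by (auto simp: bounded_operator_on_def)

lemma K_diff: "u \<in> H \<Longrightarrow> v \<in> H \<Longrightarrow> K (u - v) = K u - K v"
  using K_add[of u "- v"] K_cscale[of v "- 1"] HD(3)[of v "- 1"] by simp

lemma K_scaleR: "u \<in> H \<Longrightarrow> K (r *\<^sub>R u) = r *\<^sub>R K u"
  using K_cscale[of u "of_real r"] by (simp add: cscale_of_real)

lemma K_bound: "\<exists>C>0. \<forall>u\<in>H. norm (K u) \<le> C * norm u"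
proof -
  obtain C where C: "\<forall>u\<in>H. norm (K u) \<le> C * norm u"
    using K unfolding bounded_operator_on_def by blast
  have "norm (K u) \<le> (\<bar>C\<bar> + 1) * norm u" if "u \<in> H" for u
    by (rule order_trans[OF bspec[OF C that]]) (intro mult_right_mono, auto)
  then show ?thesis by (intro exI[of _ "\<bar>C\<bar> + 1"]) auto
qed

lemma E_in: "u \<in> H \<Longrightarrow> E u \<in> H"
  by (simp add: E_def HD K_in)

lemma E_add: "u \<in> H \<Longrightarrow> v \<in> H \<Longrightarrow> E (u + v) = E u + E v"
  by (simp add: E_def K_add cscale_add_right)

lemma E_cscale: "u \<in> H \<Longrightarrow> E (cscale c u) = cscale c (E u)"
  by (simp add: E_def K_cscale cscale_diff_right mult.commute)

lemma E_bound: "\<exists>C>0. \<forall>u\<in>H. norm (E u) \<le> C * norm u"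
proof -
  obtain C where C: "C > 0" "\<And>u. u \<in> H \<Longrightarrow> norm (K u) \<le> C * norm u" using K_bound by blast
  have "norm (E u) \<le> (cmod \<kappa> + C) * norm u" if "u \<in> H" for u
    using norm_triangle_ineq4[of "cscale \<kappa> u" "K u"] C(2)[OF that] by (simp add: E_def algebra_simps)
  then show ?thesis using C(1) by (intro exI[of _ "cmod \<kappa> + C"]) (auto intro: add_nonneg_pos)
qed

lemma Epow_in: "u \<in> H \<Longrightarrow> (E ^^ k) u \<in> H"
  by (induction k) (auto simp: E_in)

lemma Epow_add: "u \<in> H \<Longrightarrow> v \<in> H \<Longrightarrow> (E ^^ k) (u + v) = (E ^^ k) u + (E ^^ k) v"
  by (induction k) (auto simp: E_add Epow_in)

lemma Epow_cscale: "u \<in> H \<Longrightarrow> (E ^^ k) (cscale c u) = cscale c ((E ^^ k) u)"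
  by (induction k) (auto simp: E_cscale Epow_in)

lemma E_K: "u \<in> H \<Longrightarrow> E (K u) = K (E u)"
  by (simp add: E_def K_diff K_cscale HD K_in)

lemma Epow_K: "u \<in> H \<Longrightarrow> (E ^^ k) (K u) = K ((E ^^ k) u)"
  by (induction k) (auto simp: E_K Epow_in)

lemma E_0: "E 0 = 0"
  using E_cscale[of 0 0] HD(1) by simp

lemma csubspace_gker: "csubspace (gker k)"
proof -
  have "(E ^^ k) 0 = 0" by (induction k) (auto simp: E_0)
  then show ?thesis
    by (auto simp: csubspace_def gker_def HD Epow_add Epow_cscale)
qed

lemmas gkerD = csubspaceD[OF csubspace_gker]

lemma gker_H: "u \<in> gker k \<Longrightarrow> u \<in> H"
  by (simp add: gker_def)

lemma gker_mono: "j \<le> k \<Longrightarrow> gker j \<subseteq> gker k"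
proof (rule lift_Suc_mono_le[of gker])
  show "gker n \<le> gker (Suc n)" for n by (auto simp: gker_def E_0)
qed auto

lemma E_gker: "u \<in> H \<Longrightarrow> E u \<in> gker k \<longleftrightarrow> u \<in> gker (Suc k)"
  by (simp add: gker_def E_in funpow_swap1)

lemma K_gker: "u \<in> gker k \<Longrightarrow> K u \<in> gker k"
  using K_cscale[of 0 0] HD(1) by (simp add: gker_def Epow_K K_in)

lemma K_tendsto:
  assumes "\<And>k. f k \<in> H" "u \<in> H" "f \<longlonglongrightarrow> u"
  shows "(\<lambda>k. K (f k)) \<longlonglongrightarrow> K u"
proof -
  obtain C where C: "C > 0" "\<And>u. u \<in> H \<Longrightarrow> norm (K u) \<le> C * norm u" using K_bound by blast
  have "(\<lambda>k. C * norm (f k - u)) \<longlonglongrightarrow> 0"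
    using assms(3) by (intro tendsto_mult_right_zero) (simp add: LIM_zero_iff tendsto_norm_zero_iff)
  moreover have "norm (K (f k) - K u) \<le> C * norm (f k - u)" for k
    using C(2)[OF HD(4)[OF assms(1,2)]] assms(1,2) by (simp add: K_diff)
  ultimately have "(\<lambda>k. K (f k) - K u) \<longlonglongrightarrow> 0"
    by (rule Lim_null_comparison[OF always_eventually[OF allI], rotated])
  then show ?thesis by (rule LIM_zero_cancel)
qed

lemma E_tendsto:
  assumes "\<And>k. f k \<in> H" "u \<in> H" "f \<longlonglongrightarrow> u"
  shows "(\<lambda>k. E (f k)) \<longlonglongrightarrow> E u"
  unfolding E_def using K_tendsto[OF assms] assms(3)
  by (intro tendsto_diff bounded_linear.tendsto[OF bounded_linear_cscale])

lemma Epow_tendsto: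
  assumes "\<And>k. f k \<in> H" "u \<in> H" "f \<longlonglongrightarrow> u"
  shows "(\<lambda>k. (E ^^ j) (f k)) \<longlonglongrightarrow> (E ^^ j) u"
  using assms by (induction j) (auto simp: Epow_in intro!: E_tendsto)

lemma closed_gker: "closed (gker k)"
proof (unfold closed_sequential_limits, intro allI impI, elim conjE)
  fix f u assume f: "\<forall>n. f n \<in> gker k" and lim: "f \<longlonglongrightarrow> u"
  have fH: "f n \<in> H" for n using f by (auto simp: gker_def)
  then have u: "u \<in> H" using closed_H lim by (auto simp: closed_sequential_limits)
  have "(\<lambda>n. (E ^^ k) (f n)) \<longlonglongrightarrow> (E ^^ k) u"
    by (rule Epow_tendsto[OF fH u lim])
  moreover have "(\<lambda>n. (E ^^ k) (f n)) = (\<lambda>n. 0)" using f by (auto simp: gker_def)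
  ultimately have "(\<lambda>n. 0) \<longlonglongrightarrow> (E ^^ k) u" by simp
  then have "(E ^^ k) u = 0" by (simp add: LIMSEQ_const_iff)
  then show "u \<in> gker k" using u by (simp add: gker_def)
qed

text \<open>The Riesz argument: were all inclusions strict, there would be unit vectors
  \<open>u k\<close> in \<open>gker (Suc k)\<close> at distance at least 1/2 from
  \<open>gker k\<close>. For p < q their images under \<open>K\<close> then differ by at least
  |\<kappa>| / 2, which no convergent subsequence allows.\<close>

lemma gker_stabilizes: "\<exists>k. gker k = gker (Suc k)"
proof (rule ccontr)
  assume "\<not> ?thesis"
  then have "gker k \<subset> gker (Suc k)" for k using gker_mono[of k "Suc k"] by auto
  then have "\<exists>u. u \<in> gker (Suc k) \<and> norm u = 1 \<and> (\<forall>y\<in>gker k. norm (u - y) \<ge> 1/2)" for k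
    using riesz_almost_orthogonal[OF csubspace_gker closed_gker csubspace_gker] by metis
  then obtain u where u: "\<And>k. u k \<in> gker (Suc k)" "\<And>k. norm (u k) = 1"
    "\<And>k y. y \<in> gker k \<Longrightarrow> norm (u k - y) \<ge> 1/2"
    by metis
  have "range u \<subseteq> H" using u(1) gker_H by blast
  moreover have "bounded (range u)" using u(2) by (auto simp: bounded_iff)
  ultimately obtain s l where s: "strict_mono s" and l: "(\<lambda>k. K (u (s k))) \<longlonglongrightarrow> l"
    using compact_K by blast
  have "cmod \<kappa> / 2 > 0" using \<kappa> by simp
  then obtain M where M: "\<And>m n. m \<ge> M \<Longrightarrow> n \<ge> M \<Longrightarrow> norm (K (u (s m)) - K (u (s n))) < cmod \<kappa> / 2"
    using LIMSEQ_imp_Cauchy[OF l] unfolding Cauchy_def dist_norm by meson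
  define p q where "p = s M" and "q = s (Suc M)"
  have "p < q" using s by (simp add: p_def q_def strict_mono_less)
  \<comment> \<open>Chosen so that \<kappa> (u q - y) = K (u q) - K (u p). It lies in
    \<open>gker q\<close> because \<open>E\<close> lowers the level of \<open>u q\<close> by one,
    while \<open>u p\<close> is already at level \<open>Suc p\<close>, at most q.\<close>
  define y where "y = cscale (1 / \<kappa>) (E (u q) + K (u p))"
  have "E (u q) \<in> gker q" using u(1)[of q] gker_H E_gker by blast
  moreover have "K (u p) \<in> gker q"
    using K_gker[OF u(1)[of p]] gker_mono[of "Suc p" q] \<open>p < q\<close> by auto
  ultimately have "y \<in> gker q" unfolding y_def by (intro gkerD)
  then have "cmod \<kappa> * (1/2) \<le> cmod \<kappa> * norm (u q - y)"
    using u(3)[of y q] by (intro mult_left_mono) auto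
  also have "\<dots> = norm (cscale \<kappa> (u q - y))" by simp
  also have "cscale \<kappa> (u q - y) = K (u q) - K (u p)"
    using \<kappa> by (simp add: y_def E_def cscale_diff_right cscale_add_right)
  finally show False using M[of "Suc M" M] by (simp add: p_def q_def)
qed

text \<open>A sequential substitute for finite dimension. From \<kappa> f = E f + K f, the first
  term is one level lower and is covered by the induction hypothesis, the second by compactness of
  \<open>K\<close>.\<close>

lemma gker_compact:
  assumes "range f \<subseteq> gker j" "bounded (range f)"
  shows "\<exists>s l. strict_mono (s :: nat \<Rightarrow> nat) \<and> (\<lambda>k. f (s k)) \<longlonglongrightarrow> l"
  using assms
proof (induction j arbitrary: f)
  case 0
  then have "f k = 0" for k by (auto simp: gker_def)
  then show ?case by (intro exI[of _ id] exI[of _ 0]) (simp add: strict_mono_def)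
next
  case (Suc j)
  have fH: "f k \<in> H" for k using Suc.prems(1) gker_H by blast
  obtain C where C: "C > 0" "\<And>u. u \<in> H \<Longrightarrow> norm (E u) \<le> C * norm u" using E_bound by blast
  obtain b where b: "\<And>k. norm (f k) \<le> b" using Suc.prems(2) by (auto simp: bounded_iff)
  have bd: "bounded (range (\<lambda>k. E (f k)))"
    unfolding bounded_iff
  proof (intro exI ballI, elim imageE, simp)
    show "norm (E (f k)) \<le> C * b" for k
      using C(2)[OF fH[of k]] b[of k] C(1) by (meson less_imp_le mult_left_mono order_trans)
  qed
  have "range (\<lambda>k. E (f k)) \<subseteq> gker j"
    using Suc.prems(1) E_gker[OF fH] by blast
  from Suc.IH[OF this bd] obtain s l where s: "strict_mono (s :: nat \<Rightarrow> nat)" and l: "(\<lambda>k. E (f (s k))) \<longlonglongrightarrow> l"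
    by blast
  have "range (f \<circ> s) \<subseteq> H" using fH by auto
  moreover have "bounded (range (f \<circ> s))" using b by (auto simp: bounded_iff)
  ultimately obtain s' l' where s': "strict_mono s'" and l': "(\<lambda>k. K ((f \<circ> s) (s' k))) \<longlonglongrightarrow> l'"
    using compact_K by blast
  have "(\<lambda>k. cscale (1 / \<kappa>) (E (f (s (s' k))) + K (f (s (s' k))))) \<longlonglongrightarrow> cscale (1 / \<kappa>) (l + l')"
    using LIMSEQ_subseq_LIMSEQ[OF l s'] l'
    by (intro bounded_linear.tendsto[OF bounded_linear_cscale] tendsto_add) (auto simp: o_def)
  then have "(\<lambda>k. f ((s \<circ> s') k)) \<longlonglongrightarrow> cscale (1 / \<kappa>) (l + l')"
    using \<kappa> by (simp add: E_def)
  then show ?case using strict_mono_o[OF s s'] by blast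
qed

text \<open>If the bound fails, there are vectors whose distance to \<open>gker m\<close> is large
  compared with their images. Subtracting nearly closest points of \<open>gker m\<close> and
  normalizing makes them bounded; compactness then yields a limit that stays away from
  \<open>gker m\<close>, although \<open>E\<close> maps it into \<open>gker m\<close>.\<close>

lemma quotient_lower_bound:
  assumes m: "gker m = gker (Suc m)"
  shows "\<exists>C>0. \<exists>\<delta>>0. \<forall>\<sigma> v. cmod \<sigma> < \<delta> \<and> v \<in> H \<longrightarrow>
    infdist v (gker m) \<le> C * norm (cscale (\<kappa> + \<sigma>) v - K v)"
proof (rule ccontr)
  assume neg: "\<not> ?thesis"
  have "\<exists>\<sigma> v. cmod \<sigma> < 1 / real (Suc k) \<and> v \<in> H \<and>
      infdist v (gker m) > real (Suc k) * norm (cscale (\<kappa> + \<sigma>) v - K v)" for k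
    using neg[simplified not_ex not_all, rule_format, of "real (Suc k)"] by (auto simp: not_le)
  then obtain \<sigma> v where \<sigma>: "\<And>k. cmod (\<sigma> k) < 1 / real (Suc k)" and v: "\<And>k. v k \<in> H"
    and inf: "\<And>k. infdist (v k) (gker m) > real (Suc k) * norm (cscale (\<kappa> + \<sigma> k) (v k) - K (v k))"
    by metis
  define d where "d k = infdist (v k) (gker m)" for k
  have d: "d k > 0" for k
    using inf[of k] by (auto simp: d_def intro: order_le_less_trans[rotated])
  have ne: "gker m \<noteq> {}" using gkerD(1) by blast
  have "\<exists>a\<in>gker m. dist (v k) a < 2 * d k" for k
    using cInf_lessD[of "dist (v k) ` gker m" "2 * d k"] ne d[of k] by (auto simp: d_def infdist_def)
  then obtain a where a: "\<And>k. a k \<in> gker m" "\<And>k. dist (v k) (a k) < 2 * d k" by metis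
  \<comment> \<open>Dividing by the distance \<open>d k\<close> puts \<open>b k\<close> at distance
    at least 1 from \<open>gker m\<close>, and the choice of \<open>a k\<close> keeps its norm below
    2.\<close>
  define b where "b k = (1 / d k) *\<^sub>R (v k - a k)" for k
  define e where "e k = (1 / d k) *\<^sub>R (cscale (\<kappa> + \<sigma> k) (v k) - K (v k))" for k
  \<comment> \<open>The price of passing from \<open>v k\<close> to \<open>v k - a k\<close>. It
    need not tend to 0, but it stays bounded inside \<open>gker m\<close>, where
    \<open>gker_compact\<close> applies.\<close>
  define n where "n k = (1 / d k) *\<^sub>R (cscale (\<kappa> + \<sigma> k) (a k) - K (a k))" for k
  have aH: "a k \<in> H" for k using a(1) gker_H by blast
  have bH: "b k \<in> H" for k unfolding b_def using aH v by (intro HD)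
  have b2: "norm (b k) \<le> 2" for k
    using a(2)[of k] d[of k] by (simp add: b_def dist_norm divide_le_eq)
  have far: "norm (b k - y) \<ge> 1" if "y \<in> gker m" for k y
  proof -
    have "d k \<le> norm (v k - (a k + d k *\<^sub>R y))"
      using infdist_le[of "a k + d k *\<^sub>R y" "gker m" "v k"] gkerD(2,5) a(1) that
      by (auto simp: d_def dist_norm)
    also have "v k - (a k + d k *\<^sub>R y) = d k *\<^sub>R (b k - y)"
      using d[of k] by (simp add: b_def algebra_simps)
    finally have "d k * 1 \<le> d k * norm (b k - y)" using d[of k] by simp
    then show ?thesis using d[of k] by (simp only: mult_le_cancel_left_pos)
  qed
  have e: "norm (e k) \<le> 1 / real (Suc k)" for k
  proof -
    have "real (Suc k) * norm (cscale (\<kappa> + \<sigma> k) (v k) - K (v k)) \<le> d k"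
      using inf[of k] by (simp add: d_def)
    then show ?thesis
      using d[of k] unfolding e_def norm_scaleR by (simp add: field_simps del: of_nat_Suc)
  qed
  have nker: "n k \<in> gker m" for k
    unfolding n_def by (intro gkerD K_gker a(1))
  have rel: "cscale (\<kappa> + \<sigma> k) (b k) - K (b k) = e k - n k" for k
    by (simp add: b_def e_def n_def K_scaleR K_diff v aH HD cscale_scaleR cscale_diff_right algebra_simps)
  obtain C where C: "C > 0" "\<And>u. u \<in> H \<Longrightarrow> norm (K u) \<le> C * norm u" using K_bound by blast
  have \<sigma>1: "cmod (\<sigma> k) \<le> 1" for k
    using \<sigma>[of k] by (rule less_imp_le[OF less_le_trans]) simp
  have nb: "norm (n k) \<le> 1 + (cmod \<kappa> + 1) * 2 + C * 2" for k
  proof -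
    have "norm (n k) = norm (e k - cscale (\<kappa> + \<sigma> k) (b k) + K (b k))"
    proof -
      have "n k = e k - (cscale (\<kappa> + \<sigma> k) (b k) - K (b k))" by (simp add: rel)
      also have "\<dots> = e k - cscale (\<kappa> + \<sigma> k) (b k) + K (b k)" by simp
      finally show ?thesis by simp
    qed
    also have "\<dots> \<le> norm (e k) + cmod (\<kappa> + \<sigma> k) * norm (b k) + norm (K (b k))"
      using norm_triangle_ineq[of "e k - cscale (\<kappa> + \<sigma> k) (b k)" "K (b k)"]
        norm_triangle_ineq4[of "e k" "cscale (\<kappa> + \<sigma> k) (b k)"] by simp
    also have "\<dots> \<le> 1 + (cmod \<kappa> + 1) * 2 + C * 2"
    proof (intro add_mono mult_mono)
      show "norm (e k) \<le> 1" using e[of k] by (rule order_trans) simp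
      show "cmod (\<kappa> + \<sigma> k) \<le> cmod \<kappa> + 1" using norm_triangle_ineq[of \<kappa> "\<sigma> k"] \<sigma>1[of k] by simp
      show "norm (K (b k)) \<le> C * 2"
        using C(2)[OF bH[of k]] b2[of k] C(1) by (meson less_imp_le mult_left_mono order_trans)
    qed (use b2 in auto)
    finally show ?thesis .
  qed
  have "bounded (range n)" using nb by (auto simp: bounded_iff)
  then obtain s l where s: "strict_mono s" and l: "(\<lambda>k. n (s k)) \<longlonglongrightarrow> l"
    using gker_compact[of n m] nker by blast
  have "range (b \<circ> s) \<subseteq> H" "bounded (range (b \<circ> s))"
    using bH b2 by (auto simp: bounded_iff)
  then obtain s' r where s': "strict_mono s'" and r: "(\<lambda>k. K ((b \<circ> s) (s' k))) \<longlonglongrightarrow> r"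
    using compact_K by blast
  define t where "t = s \<circ> s'"
  have t: "strict_mono t" unfolding t_def by (rule strict_mono_o[OF s s'])
  have lt: "(\<lambda>k. n (t k)) \<longlonglongrightarrow> l" using LIMSEQ_subseq_LIMSEQ[OF l s'] by (simp add: t_def o_def)
  have rt: "(\<lambda>k. K (b (t k))) \<longlonglongrightarrow> r" using r by (simp add: t_def)
  have inv0: "(\<lambda>k. 1 / real (Suc k)) \<longlonglongrightarrow> 0"
    using LIMSEQ_inverse_real_of_nat by (simp add: inverse_eq_divide)
  have e0: "(\<lambda>k. e (t k)) \<longlonglongrightarrow> 0"
    using LIMSEQ_subseq_LIMSEQ[OF Lim_null_comparison[OF _ inv0, of e] t] e by (simp add: o_def)
  have \<sigma>0: "(\<lambda>k. cscale (\<sigma> (t k)) (b (t k))) \<longlonglongrightarrow> 0"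
  proof -
    have "norm (cscale (\<sigma> k) (b k)) \<le> 1 / real (Suc k) * 2" for k
      using \<sigma>[of k] b2[of k] by (simp only: norm_cscale) (intro mult_mono, auto)
    moreover have "(\<lambda>k. 1 / real (Suc k) * 2) \<longlonglongrightarrow> 0"
      using tendsto_mult[OF inv0 tendsto_const[of 2]] by simp
    ultimately have "(\<lambda>k. cscale (\<sigma> k) (b k)) \<longlonglongrightarrow> 0"
      by (rule Lim_null_comparison[OF always_eventually[OF allI]])
    from LIMSEQ_subseq_LIMSEQ[OF this t] show ?thesis by (simp add: o_def)
  qed
  have "(\<lambda>k. cscale (1 / \<kappa>) (K (b (t k)) + e (t k) - n (t k) - cscale (\<sigma> (t k)) (b (t k))))
      \<longlonglongrightarrow> cscale (1 / \<kappa>) (r + 0 - l - 0)"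
    by (intro bounded_linear.tendsto[OF bounded_linear_cscale] tendsto_intros rt e0 lt \<sigma>0)
  moreover have "cscale (1 / \<kappa>) (K (b k) + e k - n k - cscale (\<sigma> k) (b k)) = b k" for k
  proof -
    have "K (b k) + e k - n k - cscale (\<sigma> k) (b k) = cscale \<kappa> (b k)"
      using rel[of k] by (simp add: cscale_add_left algebra_simps)
    then show ?thesis using \<kappa> by simp
  qed
  ultimately have lim: "(\<lambda>k. b (t k)) \<longlonglongrightarrow> cscale (1 / \<kappa>) (r - l)" (is "_ \<longlonglongrightarrow> ?b")
    by simp
  then have b': "?b \<in> H"
    using closed_sequentially[OF closed_H bH] by blast
  have "K ?b = r"
    using LIMSEQ_unique[OF K_tendsto[OF bH b' lim] rt] .
  then have "E ?b = - l"
    using \<kappa> by (simp add: E_def)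
  moreover have "l \<in> gker m"
    by (rule closed_sequentially[OF closed_gker nker lt])
  ultimately have "E ?b \<in> gker m"
    using gkerD(3)[of l m "- 1"] by simp
  \<comment> \<open>Here stabilization enters: \<open>E ?b\<close> in \<open>gker m\<close> puts
    \<open>?b\<close> into \<open>gker (Suc m)\<close>, which is \<open>gker m\<close>, against the
    distance 1.\<close>
  then have "?b \<in> gker m" unfolding m[symmetric] E_gker[OF b'] by (simp only: m)
  then have "norm (b (t k) - ?b) \<ge> 1" for k by (rule far)
  moreover have "(\<lambda>k. norm (b (t k) - ?b)) \<longlonglongrightarrow> 0"
    using lim by (simp add: LIM_zero_iff tendsto_norm_zero_iff)
  ultimately show False
    using LIMSEQ_le_const[of "\<lambda>k. norm (b (t k) - ?b)" 0 1] by auto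
qed

text \<open>Put g = (\<sigma> + E) a. Since \<open>E\<close> commutes with \<sigma> + E, the
  induction hypothesis for \<open>E a\<close>, one level lower, bounds \<open>E a\<close> by g. Then
  \<sigma> a = g - E a bounds a, so each level costs one more factor |\<sigma>|.\<close>

lemma gker_lower_bound:
  "\<exists>C>0. \<forall>\<sigma> a. cmod \<sigma> \<le> 1 \<and> a \<in> gker k \<longrightarrow>
    cmod \<sigma> ^ k * norm a \<le> C * norm (cscale (\<kappa> + \<sigma>) a - K a)"
proof (induction k)
  case 0
  show ?case by (intro exI[of _ 1]) (auto simp: gker_def)
next
  case (Suc k)
  then obtain C where C: "C > 0" and IH: "\<And>\<sigma> a. cmod \<sigma> \<le> 1 \<Longrightarrow> a \<in> gker k \<Longrightarrow>
      cmod \<sigma> ^ k * norm a \<le> C * norm (cscale (\<kappa> + \<sigma>) a - K a)" by blast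
  obtain D where D: "D > 0" "\<And>u. u \<in> H \<Longrightarrow> norm (E u) \<le> D * norm u" using E_bound by blast
  have "cmod \<sigma> ^ Suc k * norm a \<le> (1 + C * D) * norm (cscale (\<kappa> + \<sigma>) a - K a)"
    if \<sigma>: "cmod \<sigma> \<le> 1" and a: "a \<in> gker (Suc k)" for \<sigma> a
  proof -
    have aH: "a \<in> H" by (rule gker_H[OF a])
    define g where "g = cscale (\<kappa> + \<sigma>) a - K a"
    have gE: "g = cscale \<sigma> a + E a" by (simp add: g_def E_def cscale_add_left)
    have gH: "g \<in> H" unfolding g_def using aH by (intro HD K_in)
    have Eg: "cscale (\<kappa> + \<sigma>) (E a) - K (E a) = E g"
      by (simp add: gE E_add E_cscale HD E_in aH) (simp add: E_def[of "E a"] cscale_add_left)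
    have "cmod \<sigma> ^ k * norm (E a) \<le> C * norm (E g)"
      using IH[OF \<sigma>, of "E a"] a aH by (simp add: E_gker Eg)
    also have "\<dots> \<le> C * (D * norm g)" using C D(2)[OF gH] by (intro mult_left_mono) auto
    finally have 1: "cmod \<sigma> ^ k * norm (E a) \<le> C * D * norm g" by simp
    have "cmod \<sigma> * norm a \<le> norm g + norm (E a)"
      using norm_triangle_ineq4[of g "E a"] by (simp add: gE)
    then have "cmod \<sigma> ^ k * (cmod \<sigma> * norm a) \<le> cmod \<sigma> ^ k * (norm g + norm (E a))"
      by (intro mult_left_mono) auto
    also have "\<dots> \<le> norm g + C * D * norm g"
      using 1 mult_right_mono[OF power_le_one[OF _ \<sigma>, of k], of "norm g"] by (simp add: algebra_simps)
    finally show ?thesis by (simp add: g_def algebra_simps)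
  qed
  then show ?case using C D(1) by (intro exI[of _ "1 + C * D"]) (auto intro: add_pos_pos)
qed

text \<open>Split v = a + (v - a) with a in \<open>gker m\<close> nearly closest to v. The quotient
  bound controls v - a by the image g of v, hence also the image of a by g, and then the bound on
  \<open>gker m\<close> applies to a.\<close>

lemma inverse_growth:
  assumes m: "gker m = gker (Suc m)"
  shows "\<exists>C>0. \<exists>\<delta>>0. \<forall>\<sigma> v. cmod \<sigma> < \<delta> \<and> v \<in> H \<longrightarrow>
    cmod \<sigma> ^ m * norm v \<le> C * norm (cscale (\<kappa> + \<sigma>) v - K v)"
proof -
  obtain C1 \<delta> where C1: "C1 > 0" "\<delta> > 0" and inf: "\<And>\<sigma> v. cmod \<sigma> < \<delta> \<Longrightarrow> v \<in> H \<Longrightarrow>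
      infdist v (gker m) \<le> C1 * norm (cscale (\<kappa> + \<sigma>) v - K v)"
    using quotient_lower_bound[OF m] by blast
  obtain C2 where C2: "C2 > 0" and low: "\<And>\<sigma> a. cmod \<sigma> \<le> 1 \<Longrightarrow> a \<in> gker m \<Longrightarrow>
      cmod \<sigma> ^ m * norm a \<le> C2 * norm (cscale (\<kappa> + \<sigma>) a - K a)"
    using gker_lower_bound[of m] by blast
  obtain C3 where C3: "C3 > 0" "\<And>u. u \<in> H \<Longrightarrow> norm (K u) \<le> C3 * norm u" using K_bound by blast
  \<comment> \<open>A bound for the norm of \<kappa> + \<sigma> - K when |\<sigma>| is at most
    1.\<close>
  define L where "L = cmod \<kappa> + 1 + C3"
  have L: "L > 0" using C3(1) by (simp add: L_def add_nonneg_pos add_pos_pos)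
  define C where "C = C2 * (1 + L * (C1 + 1)) + (C1 + 1)"
  have "cmod \<sigma> ^ m * norm v \<le> C * norm (cscale (\<kappa> + \<sigma>) v - K v)"
    if \<sigma>: "cmod \<sigma> < min \<delta> 1" and v: "v \<in> H" for \<sigma> v
  proof -
    have \<sigma>1: "cmod \<sigma> \<le> 1" using \<sigma> by simp
    define g where "g = cscale (\<kappa> + \<sigma>) v - K v"
    have ne: "gker m \<noteq> {}" using gkerD(1) by blast
    \<comment> \<open>The infimum behind \<open>infdist\<close> is not known to be attained, so
      \<open>C1\<close> is enlarged by 1. That gives no slack when g = 0, but then v itself lies in
      the closed space \<open>gker m\<close>.\<close>
    have "\<exists>a\<in>gker m. norm (v - a) \<le> (C1 + 1) * norm g"
    proof (cases "g = 0")
      case True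
      then have "infdist v (gker m) = 0"
        using inf[of \<sigma> v] \<sigma> v infdist_nonneg[of v "gker m"] by (simp add: g_def)
      then have "v \<in> gker m" using in_closed_iff_infdist_zero[OF closed_gker ne] by simp
      then show ?thesis using True by (intro bexI[of _ v]) auto
    next
      case False
      then have "norm g > 0" by simp
      moreover have "infdist v (gker m) \<le> C1 * norm g"
        using inf[of \<sigma> v] \<sigma> v by (simp add: g_def)
      ultimately have "infdist v (gker m) < (C1 + 1) * norm g"
        unfolding distrib_right by linarith
      then obtain a where "a \<in> gker m" "dist v a < (C1 + 1) * norm g"
        using cInf_lessD[of "dist v ` gker m"] ne by (auto simp: infdist_def)
      then show ?thesis by (intro bexI[of _ a]) (auto simp: dist_norm)
    qed
    then obtain a where a: "a \<in> gker m" "norm (v - a) \<le> (C1 + 1) * norm g" by blast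
    have aH: "a \<in> H" by (rule gker_H[OF a(1)])
    have "norm (cscale (\<kappa> + \<sigma>) (v - a) - K (v - a)) \<le> L * norm (v - a)"
    proof -
      have "norm (cscale (\<kappa> + \<sigma>) (v - a) - K (v - a)) \<le> cmod (\<kappa> + \<sigma>) * norm (v - a) + C3 * norm (v - a)"
        using norm_triangle_ineq4[of "cscale (\<kappa> + \<sigma>) (v - a)" "K (v - a)"] C3(2)[OF HD(4)[OF v aH]]
        by simp
      also have "\<dots> \<le> (cmod \<kappa> + 1) * norm (v - a) + C3 * norm (v - a)"
        using norm_triangle_ineq[of \<kappa> \<sigma>] \<sigma>1 by (intro add_mono mult_right_mono) auto
      finally show ?thesis by (simp add: L_def algebra_simps)
    qed
    also have "\<dots> \<le> L * ((C1 + 1) * norm g)" using a(2) L by (intro mult_left_mono) auto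
    finally have 1: "norm (cscale (\<kappa> + \<sigma>) (v - a) - K (v - a)) \<le> L * ((C1 + 1) * norm g)" .
    have "cscale (\<kappa> + \<sigma>) a - K a = g - (cscale (\<kappa> + \<sigma>) (v - a) - K (v - a))"
      by (simp add: g_def K_diff v aH cscale_diff_right)
    then have "norm (cscale (\<kappa> + \<sigma>) a - K a) \<le> norm g + L * ((C1 + 1) * norm g)"
      using norm_triangle_ineq4[of g "cscale (\<kappa> + \<sigma>) (v - a) - K (v - a)"] 1 by simp
    then have "C2 * norm (cscale (\<kappa> + \<sigma>) a - K a) \<le> C2 * (norm g + L * ((C1 + 1) * norm g))"
      using C2 by (intro mult_left_mono) auto
    then have 2: "cmod \<sigma> ^ m * norm a \<le> C2 * (norm g + L * ((C1 + 1) * norm g))"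
      using low[OF \<sigma>1 a(1)] by simp
    have "norm v \<le> norm a + norm (v - a)" using norm_triangle_ineq[of a "v - a"] by simp
    then have "cmod \<sigma> ^ m * norm v \<le> cmod \<sigma> ^ m * norm a + cmod \<sigma> ^ m * norm (v - a)"
      using mult_left_mono[of "norm v" "norm a + norm (v - a)" "cmod \<sigma> ^ m"] by (simp add: algebra_simps)
    also have "cmod \<sigma> ^ m * norm (v - a) \<le> 1 * norm (v - a)"
      using power_le_one[OF _ \<sigma>1, of m] by (intro mult_right_mono) auto
    finally have "cmod \<sigma> ^ m * norm v \<le> C2 * (norm g + L * ((C1 + 1) * norm g)) + (C1 + 1) * norm g"
      using 2 a(2) by simp
    then show ?thesis by (simp add: C_def g_def algebra_simps)
  qed
  moreover have "C > 0" using C1 C2 L by (simp add: C_def add_pos_pos)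
  moreover have "min \<delta> 1 > 0" using C1 by simp
  ultimately show ?thesis by blast
qed

end

subsection \<open>Multiplication by a bounded matrix field\<close>

lemma csubspace_L2: "csubspace (L2 \<Omega> :: ('n::finite, 'm::finite) L2 set)"
  unfolding csubspace_def
proof (intro conjI ballI allI)
  have "AE x in lebesgue. rep_l2 (0 :: ('n, 'm) L2) x = 0"
    using rep_cscale[of 0 "0 :: ('n, 'm) L2"] by eventually_elim simp
  then show "(0 :: ('n, 'm) L2) \<in> L2 \<Omega>"
    unfolding L2_def mem_Collect_eq by eventually_elim simp
next
  fix u v :: "('n, 'm) L2" and c
  assume u: "u \<in> L2 \<Omega>"
  show "cscale c u \<in> L2 \<Omega>"
    using u rep_cscale[of c u] unfolding L2_def mem_Collect_eq by eventually_elim simp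
  assume "v \<in> L2 \<Omega>"
  then show "u + v \<in> L2 \<Omega>"
    using u rep_l2_add[of u v] unfolding L2_def mem_Collect_eq by eventually_elim simp
qed

lemma norm_matrix_vector_le:
  fixes A :: "complex^'m^'m"
  shows "norm (A *v x) \<le> real CARD('m) * real CARD('m) * norm A * norm x"
proof -
  have "norm (A *v x) \<le> (\<Sum>i\<in>UNIV. norm ((A *v x) $ i))"
    unfolding norm_vec_def by (intro L2_set_le_sum) auto
  also have "\<dots> \<le> (\<Sum>i\<in>(UNIV::'m set). real CARD('m) * (norm A * norm x))"
  proof (rule sum_mono)
    fix i
    have "norm ((A *v x) $ i) \<le> (\<Sum>j\<in>UNIV. norm (A $ i $ j * x $ j))"
      unfolding matrix_vector_mult_def by (simp add: norm_sum)
    also have "\<dots> \<le> (\<Sum>j\<in>(UNIV::'m set). norm A * norm x)"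
    proof (rule sum_mono)
      fix j
      have "norm (A $ i $ j) \<le> norm A"
        using Finite_Cartesian_Product.norm_nth_le[of "A $ i" j] Finite_Cartesian_Product.norm_nth_le[of A i]
        by (rule order_trans)
      then show "norm (A $ i $ j * x $ j) \<le> norm A * norm x"
        unfolding norm_mult by (intro mult_mono Finite_Cartesian_Product.norm_nth_le) auto
    qed
    finally show "norm ((A *v x) $ i) \<le> real CARD('m) * (norm A * norm x)" by simp
  qed
  finally show ?thesis by (simp add: mult.assoc)
qed

lemma continuous_matrix_vector: "continuous_on UNIV (\<lambda>p. (fst p :: complex^'m^'m) *v snd p)"
  unfolding matrix_vector_mult_def by (intro continuous_intros)

locale bounded_matrix_field =
  fixes \<Omega> :: "(real^'n) set" and B :: "real^'n \<Rightarrow> complex^'m^'m"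
  assumes \<Omega>: "open \<Omega>" and B: "L_infinity \<Omega> B"
begin

lemma sets_\<Omega>: "\<Omega> \<in> sets lebesgue"
  using \<Omega> by (simp add: sets_completionI_sets)

lemma AE_\<Omega>: "(AE x in lebesgue_on \<Omega>. P x) \<longleftrightarrow> (AE x in lebesgue. x \<in> \<Omega> \<longrightarrow> P x)"
  using sets_\<Omega> by (simp add: AE_restrict_space_iff)

lemma field_bound: "\<exists>C>0. AE x in lebesgue. x \<in> \<Omega> \<longrightarrow> (\<forall>v. norm (B x *v v) \<le> C * norm v)"
proof -
  obtain C where C: "AE x in lebesgue. x \<in> \<Omega> \<longrightarrow> norm (B x) \<le> C"
    using B by (auto simp: L_infinity_def AE_\<Omega>)
  define C' where "C' = real CARD('m) * real CARD('m) * (\<bar>C\<bar> + 1)"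
  have "AE x in lebesgue. x \<in> \<Omega> \<longrightarrow> (\<forall>v. norm (B x *v v) \<le> C' * norm v)"
    using C
  proof eventually_elim
    case (elim x)
    show ?case
    proof (intro impI allI)
      fix v :: "complex^'m"
      assume "x \<in> \<Omega>"
      then have "norm (B x) \<le> \<bar>C\<bar> + 1" using elim by simp
      then have "real CARD('m) * real CARD('m) * norm (B x) * norm v \<le> C' * norm v"
        unfolding C'_def by (intro mult_right_mono mult_left_mono) auto
      then show "norm (B x *v v) \<le> C' * norm v"
        using norm_matrix_vector_le[of "B x" v] by linarith
    qed
  qed
  moreover have "C' > 0" by (simp add: C'_def add_nonneg_pos)
  ultimately show ?thesis by blast
qed

text \<open>This makes the use of \<open>abs_l2\<close> in \<open>matrix_mult_op\<close> legitimate.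
  Measurability of B is given only on \<Omega>, so the product is treated there and then extended by
  zero.\<close>

lemma sq_integrable_field:
  assumes "sq_integrable f"
  shows "sq_integrable (\<lambda>x. if x \<in> \<Omega> then B x *v f x else 0)" (is "sq_integrable ?g")
proof -
  have f: "f \<in> borel_measurable lebesgue" "integrable lebesgue (\<lambda>x. (norm (f x))\<^sup>2)"
    using assms by (auto simp: sq_integrable_def)
  have "(\<lambda>x. B x *v f x) \<in> borel_measurable (lebesgue_on \<Omega>)"
    using B measurable_restrict_space1[OF f(1)]
    by (intro borel_measurable_continuous_Pair[OF _ _ continuous_matrix_vector]) (auto simp: L_infinity_def)
  then have g: "?g \<in> borel_measurable lebesgue"
    using borel_measurable_if_I[OF _ sets_\<Omega>] by blast
  obtain C where "C > 0" and C: "AE x in lebesgue. x \<in> \<Omega> \<longrightarrow> (\<forall>v. norm (B x *v v) \<le> C * norm v)"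
    using field_bound by blast
  have "integrable lebesgue (\<lambda>x. (norm (?g x))\<^sup>2)"
  proof (rule Bochner_Integration.integrable_bound)
    show "integrable lebesgue (\<lambda>x. C\<^sup>2 * (norm (f x))\<^sup>2)" using f(2) by simp
    show "(\<lambda>x. (norm (?g x))\<^sup>2) \<in> borel_measurable lebesgue" using g by measurable
    show "AE x in lebesgue. norm ((norm (?g x))\<^sup>2) \<le> norm (C\<^sup>2 * (norm (f x))\<^sup>2)"
      using C
    proof eventually_elim
      case (elim x)
      then show ?case
        using power_mono[of "norm (B x *v f x)" "C * norm (f x)" 2] by (auto simp: power_mult_distrib)
    qed
  qed
  then show ?thesis using g by (simp add: sq_integrable_def)
qed

abbreviation M where "M \<equiv> matrix_mult_op \<Omega> B"

lemma rep_M: "AE x in lebesgue. rep_l2 (M u) x = (if x \<in> \<Omega> then B x *v rep_l2 u x else 0)"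
  unfolding matrix_mult_op_def by (rule rep_abs_l2[OF sq_integrable_field[OF sq_integrable_rep_l2]])

lemma M_add: "M (u + v) = M u + M v"
  by (rule l2_eqI, use rep_M[of "u + v"] rep_M[of u] rep_M[of v] rep_l2_add[of u v]
      rep_l2_add[of "M u" "M v"] in eventually_elim)
    (simp add: matrix_vector_right_distrib)

lemma M_cscale: "M (cscale c u) = cscale c (M u)"
  by (rule l2_eqI, use rep_M[of "cscale c u"] rep_M[of u] rep_cscale[of c u] rep_cscale[of c "M u"]
      in eventually_elim)
    (auto simp: matrix_vector_mult_def vec_eq_iff sum_distrib_left algebra_simps)

lemma M_bound: "\<exists>C>0. \<forall>u. norm (M u) \<le> C * norm u"
proof -
  obtain C where "C > 0" and C: "AE x in lebesgue. x \<in> \<Omega> \<longrightarrow> (\<forall>v. norm (B x *v v) \<le> C * norm v)"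
    using field_bound by blast
  have "norm (M u) \<le> C * norm u" for u
  proof -
    have "(norm (M u))\<^sup>2 \<le> (\<integral>x. C\<^sup>2 * (norm (rep_l2 u x))\<^sup>2 \<partial>lebesgue)"
      unfolding norm_l2_rep
    proof (rule integral_mono_AE)
      show "integrable lebesgue (\<lambda>x. (norm (rep_l2 (M u) x))\<^sup>2)"
        "integrable lebesgue (\<lambda>x. C\<^sup>2 * (norm (rep_l2 u x))\<^sup>2)"
        using sq_integrable_rep_l2[of u] sq_integrable_rep_l2[of "M u"] by (auto simp: sq_integrable_def)
      show "AE x in lebesgue. (norm (rep_l2 (M u) x))\<^sup>2 \<le> C\<^sup>2 * (norm (rep_l2 u x))\<^sup>2"
        using C rep_M[of u]
      proof eventually_elim
        case (elim x)
        then show ?case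
          using power_mono[of "norm (B x *v rep_l2 u x)" "C * norm (rep_l2 u x)" 2]
          by (auto simp: power_mult_distrib)
      qed
    qed
    also have "\<dots> = (C * norm u)\<^sup>2" by (simp add: norm_l2_rep power_mult_distrib)
    finally show ?thesis using \<open>C > 0\<close> by (auto intro: power2_le_imp_le)
  qed
  then show ?thesis using \<open>C > 0\<close> by blast
qed

text \<open>Outside \<Omega> the function \<open>M u\<close> is zero, so the pointwise inequality
  integrates over the whole space because u vanishes there too.\<close>

lemma M_accretive:
  assumes "strictly_accretive \<Omega> B"
  shows "\<exists>\<beta>>0. \<forall>u\<in>L2 \<Omega>. \<beta> * (norm u)\<^sup>2 \<le> inner (M u) u"
proof -
  obtain \<beta> where "\<beta> > 0" and \<beta>: "AE x in lebesgue. x \<in> \<Omega> \<longrightarrow> (\<forall>v. inner (B x *v v) v \<ge> \<beta> * (norm v)\<^sup>2)"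
    using assms by (auto simp: strictly_accretive_def AE_\<Omega> Re_hdot)
  have "\<beta> * (norm u)\<^sup>2 \<le> inner (M u) u" if "u \<in> L2 \<Omega>" for u
  proof -
    have "(\<integral>x. \<beta> * (norm (rep_l2 u x))\<^sup>2 \<partial>lebesgue) \<le> inner (M u) u"
      unfolding inner_l2_rep
    proof (rule integral_mono_AE)
      show "integrable lebesgue (\<lambda>x. rep_l2 (M u) x \<bullet> rep_l2 u x)"
        by (intro integrable_inner sq_integrable_rep_l2)
      show "integrable lebesgue (\<lambda>x. \<beta> * (norm (rep_l2 u x))\<^sup>2)"
        using sq_integrable_rep_l2[of u] by (auto simp: sq_integrable_def)
      have "AE x in lebesgue. x \<notin> \<Omega> \<longrightarrow> rep_l2 u x = 0" using that by (simp add: L2_def)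
      with \<beta> rep_M[of u] show "AE x in lebesgue. \<beta> * (norm (rep_l2 u x))\<^sup>2 \<le> rep_l2 (M u) x \<bullet> rep_l2 u x"
        by eventually_elim auto
    qed
    then show ?thesis by (simp add: norm_l2_rep)
  qed
  then show ?thesis using \<open>\<beta> > 0\<close> by blast
qed

end

subsection \<open>Resolvents\<close>

text \<open>The algebraic part of \<open>operator_in\<close>. For D and T the ambient space and
  single-valuedness are established separately from linearity.\<close>

definition linear_relation :: "('n::finite, 'm::finite) op \<Rightarrow> bool" where
  "linear_relation A \<longleftrightarrow> (0, 0) \<in> A \<and>
     (\<forall>u v u' v'. (u, v) \<in> A \<and> (u', v') \<in> A \<longrightarrow> (u + u', v + v') \<in> A) \<and>
     (\<forall>c u v. (u, v) \<in> A \<longrightarrow> (cscale c u, cscale c v) \<in> A)"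

lemma linear_relationD:
  assumes "linear_relation A"
  shows "(0, 0) \<in> A" "(u, v) \<in> A \<Longrightarrow> (u', v') \<in> A \<Longrightarrow> (u + u', v + v') \<in> A"
    "(u, v) \<in> A \<Longrightarrow> (cscale c u, cscale c v) \<in> A"
    "(u, v) \<in> A \<Longrightarrow> (u', v') \<in> A \<Longrightarrow> (u - u', v - v') \<in> A"
proof -
  show "(0, 0) \<in> A" using assms by (simp add: linear_relation_def)
  show add: "(u, v) \<in> A \<Longrightarrow> (u', v') \<in> A \<Longrightarrow> (u + u', v + v') \<in> A" for u v u' v'
    using assms by (simp add: linear_relation_def)
  show cs: "(u, v) \<in> A \<Longrightarrow> (cscale c u, cscale c v) \<in> A" for c u v
    using assms by (simp add: linear_relation_def)
  show "(u, v) \<in> A \<Longrightarrow> (u', v') \<in> A \<Longrightarrow> (u - u', v - v') \<in> A"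
    using add[of u v "- u'" "- v'"] cs[of u' v' "- 1"] by simp
qed

lemma op_shift_iff: "(u, f) \<in> op_shift z A \<longleftrightarrow> (u, cscale z u - f) \<in> A"
  by (auto simp: op_shift_def) (metis diff_diff_eq2 add_diff_cancel_left' diff_add_cancel)

lemma resolvent_unique:
  assumes "z \<in> resolvent_set X A" "(u, f) \<in> op_shift z A"
  shows "resolvent A z f = u"
  using assms unfolding resolvent_set_def resolvent_def
  by (intro the_equality) (auto dest: single_valuedD)

lemma resolvent_in:
  assumes "z \<in> resolvent_set X A" "f \<in> X"
  shows "(resolvent A z f, f) \<in> op_shift z A"
proof -
  have "f \<in> Domain ((op_shift z A)\<inverse>)" using assms by (simp add: resolvent_set_def)
  then obtain u where "(u, f) \<in> op_shift z A" by auto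
  then show ?thesis using resolvent_unique[OF assms(1)] by metis
qed

lemma resolvent_graph:
  assumes "z \<in> resolvent_set X A" "f \<in> X"
  shows "(resolvent A z f, cscale z (resolvent A z f) - f) \<in> A"
  using resolvent_in[OF assms] by (simp add: op_shift_iff)

lemma resolvent_eqI:
  assumes "z \<in> resolvent_set X A" "(u, cscale z u - f) \<in> A"
  shows "resolvent A z f = u"
  using resolvent_unique[OF assms(1)] assms(2) by (simp add: op_shift_iff)

lemma resolvent_bound:
  assumes "z \<in> resolvent_set X A"
  shows "\<exists>C>0. \<forall>f\<in>X. norm (resolvent A z f) \<le> C * norm f"
proof -
  obtain C where C: "\<forall>(f, u)\<in>(op_shift z A)\<inverse>. norm u \<le> C * norm f"
    using assms by (auto simp: resolvent_set_def)
  have "norm (resolvent A z f) \<le> (\<bar>C\<bar> + 1) * norm f" if "f \<in> X" for f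
  proof (rule order_trans)
    show "norm (resolvent A z f) \<le> C * norm f"
      using C resolvent_in[OF assms that] by auto
    show "C * norm f \<le> (\<bar>C\<bar> + 1) * norm f" by (intro mult_right_mono) auto
  qed
  then show ?thesis by (intro exI[of _ "\<bar>C\<bar> + 1"]) auto
qed

lemma bounded_operator_resolvent:
  assumes z: "z \<in> resolvent_set X A" and A: "linear_relation A" "A \<subseteq> X \<times> X" and X: "csubspace X"
  shows "bounded_operator_on X (resolvent A z)"
  unfolding bounded_operator_on_def
proof (intro conjI ballI allI)
  fix u v c assume u: "u \<in> X"
  show "resolvent A z u \<in> X" using resolvent_graph[OF z u] A(2) by auto
  show "resolvent A z (cscale c u) = cscale c (resolvent A z u)"
    using linear_relationD(3)[OF A(1) resolvent_graph[OF z u], of c]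
    by (intro resolvent_eqI[OF z]) (simp add: cscale_diff_right mult.commute)
  assume v: "v \<in> X"
  show "resolvent A z (u + v) = resolvent A z u + resolvent A z v"
    using linear_relationD(2)[OF A(1) resolvent_graph[OF z u] resolvent_graph[OF z v]]
    by (intro resolvent_eqI[OF z]) (simp add: cscale_add_right algebra_simps)
next
  show "\<exists>C. \<forall>u\<in>X. norm (resolvent A z u) \<le> C * norm u"
    using resolvent_bound[OF z] by blast
qed

lemma compact_operator_subseq:
  assumes "compact_operator_on X K" "range f \<subseteq> X" "bounded (range f)"
  shows "\<exists>s l. strict_mono (s :: nat \<Rightarrow> nat) \<and> (\<lambda>k. K (f (s k))) \<longlonglongrightarrow> l"
proof -
  have "compact (closure (K ` range f))"
    using assms by (auto simp: compact_operator_on_def)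
  then have "seq_compact (closure (K ` range f))" by (simp add: compact_eq_seq_compact_metric)
  moreover have "K (f k) \<in> closure (K ` range f)" for k by (rule subsetD[OF closure_subset]) simp
  ultimately obtain l s where "strict_mono s" "((\<lambda>k. K (f k)) \<circ> s) \<longlonglongrightarrow> l"
    using seq_compactE[of "closure (K ` range f)" "\<lambda>k. K (f k)"] by metis
  then show ?thesis by (auto simp: o_def)
qed

section \<open>The resolvent identity, continuity and weak holomorphy\<close>

locale linear_operator_in =
  fixes H :: "('n::finite, 'm::finite) L2 set" and T :: "('n, 'm) op"
  assumes H: "csubspace H" and closed_H: "closed H"
    and T: "linear_relation T" and T_sub: "T \<subseteq> H \<times> H"
    and T_single: "single_valued T"
begin

abbreviation \<rho> where "\<rho> \<equiv> resolvent_set H T"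
abbreviation R where "R \<equiv> resolvent T"

lemmas HD = csubspaceD[OF H]

lemma R_bounded: "z \<in> \<rho> \<Longrightarrow> bounded_operator_on H (R z)"
  by (rule bounded_operator_resolvent[OF _ T T_sub H])

lemma R_in: "z \<in> \<rho> \<Longrightarrow> f \<in> H \<Longrightarrow> R z f \<in> H"
  and R_add: "z \<in> \<rho> \<Longrightarrow> f \<in> H \<Longrightarrow> g \<in> H \<Longrightarrow> R z (f + g) = R z f + R z g"
  and R_cscale: "z \<in> \<rho> \<Longrightarrow> f \<in> H \<Longrightarrow> R z (cscale c f) = cscale c (R z f)"
  using R_bounded[of z] by (auto simp: bounded_operator_on_def)

text \<open>Applying z - T to \<open>R w f\<close> gives f + (z - w) R w f; uniqueness of the
  resolvent turns this into the identity.\<close>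

lemma resolvent_identity:
  assumes "z \<in> \<rho>" "w \<in> \<rho>" "f \<in> H"
  shows "R z f - R w f = cscale (w - z) (R z (R w f))"
proof -
  have "R z (f + cscale (z - w) (R w f)) = R w f"
    using resolvent_graph[OF assms(2,3)]
    by (intro resolvent_eqI[OF assms(1)]) (simp add: cscale_diff_left algebra_simps)
  then have "R z f + cscale (z - w) (R z (R w f)) = R w f"
    using assms by (simp add: R_add R_cscale R_in HD)
  then show ?thesis
    using cscale_simps(6)[of "z - w" "R z (R w f)"] by (simp add: algebra_simps)
qed

text \<open>Since z is already in the resolvent set, no Neumann series is summed. For |z - w| < 1 /
  (2 C), the resolvent identity bounds \<open>R z f\<close> by C |f| plus half its own norm, which
  is absorbed on the left.\<close>

lemma resolvent_locally_bounded:
  assumes w: "w \<in> \<rho>"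
  shows "\<exists>C>0. \<exists>d>0. \<forall>z\<in>\<rho>. cmod (z - w) < d \<longrightarrow> (\<forall>f\<in>H. norm (R z f) \<le> C * norm f)"
proof -
  obtain C where C: "C > 0" "\<And>f. f \<in> H \<Longrightarrow> norm (R w f) \<le> C * norm f"
    using resolvent_bound[OF w] by blast
  have "norm (R z f) \<le> (2 * C) * norm f" if z: "z \<in> \<rho>" "cmod (z - w) < 1 / (2 * C)" and f: "f \<in> H" for z f
  proof -
    have "R z f = R w f - cscale (z - w) (R w (R z f))"
      using resolvent_identity[OF w z(1) f] by (simp add: algebra_simps)
    then have "norm (R z f) \<le> norm (R w f) + cmod (z - w) * norm (R w (R z f))"
      using norm_triangle_ineq4[of "R w f" "cscale (z - w) (R w (R z f))"] by simp
    also have "\<dots> \<le> C * norm f + 1 / (2 * C) * (C * norm (R z f))"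
      using z C(1) C(2)[OF f] C(2)[OF R_in[OF z(1) f]] by (intro add_mono mult_mono) auto
    finally show ?thesis using C(1) by simp
  qed
  then show ?thesis using C(1) by (intro exI[of _ "2 * C"] conjI exI[of _ "1 / (2 * C)"]) auto
qed

lemma resolvent_continuous:
  assumes w: "w \<in> \<rho>" and U: "U \<subseteq> \<rho>" and f: "f \<in> H"
  shows "((\<lambda>z. R z f) \<longlongrightarrow> R w f) (at w within U)"
proof -
  obtain C d where C: "C > 0" "d > 0"
    and bd: "\<And>z f. z \<in> \<rho> \<Longrightarrow> cmod (z - w) < d \<Longrightarrow> f \<in> H \<Longrightarrow> norm (R z f) \<le> C * norm f"
    using resolvent_locally_bounded[OF w] by blast
  have "((\<lambda>z. R z f - R w f) \<longlongrightarrow> 0) (at w within U)"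
  proof (rule Lim_null_comparison)
    show "\<forall>\<^sub>F z in at w within U. norm (R z f - R w f) \<le> cmod (z - w) * (C * norm (R w f))"
      unfolding eventually_at
    proof (intro exI[of _ d] conjI ballI impI)
      fix z assume z: "z \<in> U" "z \<noteq> w \<and> dist z w < d"
      then have "norm (R z (R w f)) \<le> C * norm (R w f)"
        using U R_in[OF w f] by (intro bd) (auto simp: dist_norm)
      then show "norm (R z f - R w f) \<le> cmod (z - w) * (C * norm (R w f))"
        using resolvent_identity[of z w f] z U w f
        by (auto simp: norm_minus_commute[of w z] intro!: mult_left_mono)
    qed (rule C(2))
    have "((\<lambda>z. cmod (z - w) * (C * norm (R w f))) \<longlongrightarrow> cmod (w - w) * (C * norm (R w f))) (at w within U)"
      by (intro tendsto_intros)
    then show "((\<lambda>z. cmod (z - w) * (C * norm (R w f))) \<longlongrightarrow> 0) (at w within U)" by simp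
  qed
  then show ?thesis by (rule LIM_zero_cancel)
qed

text \<open>By the resolvent identity the difference quotient equals - <R z R w f, y>, so continuity
  of the resolvent gives the derivative.\<close>

lemma resolvent_holomorphic:
  assumes U: "U \<subseteq> \<rho>" and f: "f \<in> H"
  shows "(\<lambda>z. cinner (R z f) y) holomorphic_on U"
  unfolding holomorphic_on_def
proof
  fix w assume "w \<in> U"
  then have w: "w \<in> \<rho>" using U by blast
  interpret cinner: bounded_linear "\<lambda>v. cinner v y" by (rule bounded_linear_cinner_left)
  have "((\<lambda>z. - cinner (R z (R w f)) y) \<longlongrightarrow> - cinner (R w (R w f)) y) (at w within U)"
    by (intro tendsto_minus cinner.tendsto resolvent_continuous[OF w U R_in[OF w f]])
  moreover have "\<forall>\<^sub>F z in at w within U.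
      - cinner (R z (R w f)) y = (cinner (R z f) y - cinner (R w f) y) / (z - w)"
    unfolding eventually_at
  proof (intro exI[of _ 1] conjI ballI impI)
    fix z assume z: "z \<in> U" "z \<noteq> w \<and> dist z w < 1"
    have "cinner (R z f) y - cinner (R w f) y = (w - z) * cinner (R z (R w f)) y"
      using resolvent_identity[of z w f] z U w f
      by (auto simp: cinner.diff[symmetric] cinner_cscale_left)
    then show "- cinner (R z (R w f)) y = (cinner (R z f) y - cinner (R w f) y) / (z - w)"
      using z by (simp add: field_simps)
  qed simp
  ultimately have "((\<lambda>z. (cinner (R z f) y - cinner (R w f) y) / (z - w)) \<longlongrightarrow>
      - cinner (R w (R w f)) y) (at w within U)"
    by (rule Lim_transform_eventually)
  then have "((\<lambda>z. cinner (R z f) y) has_field_derivative - cinner (R w (R w f)) y) (at w within U)"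
    by (simp add: has_field_derivative_iff)
  then show "(\<lambda>z. cinner (R z f) y) field_differentiable at w within U"
    by (auto simp: field_differentiable_def)
qed

end

section \<open>Generalized eigenspaces of T and growth of its resolvent\<close>

locale eigenvalue_compact_resolvent = linear_operator_in +
  fixes z0 lam :: complex
  assumes z0: "z0 \<in> \<rho>" and lam: "z0 \<noteq> lam"
    and compact: "\<And>f :: nat \<Rightarrow> _. range f \<subseteq> H \<Longrightarrow> bounded (range f) \<Longrightarrow>
      \<exists>s l. strict_mono s \<and> (\<lambda>k. R z0 (f (s k))) \<longlonglongrightarrow> l"
begin

abbreviation \<kappa> where "\<kappa> \<equiv> 1 / (z0 - lam)"

sublocale compact_perturbation H "R z0" \<kappa>
  by unfold_locales (use H closed_H R_bounded[OF z0] compact lam in auto)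

text \<open>The factorization \<kappa> - R z0 = \<kappa> R z0 (lam - T) on the domain of T; it links
  the powers of lam - T to those of \<open>E\<close>.\<close>

lemma E_resolvent:
  assumes "(u, v) \<in> op_shift lam T"
  shows "u \<in> H" "v \<in> H" "E u = cscale \<kappa> (R z0 v)"
proof -
  have T': "(u, cscale lam u - v) \<in> T" using assms by (simp add: op_shift_iff)
  then show u: "u \<in> H" and v: "v \<in> H"
    using T_sub HD(4)[of "cscale lam u" "cscale lam u - v"] HD(3)[of u lam] by auto
  have "R z0 (cscale (z0 - lam) u + v) = u"
    using T' by (intro resolvent_eqI[OF z0]) (simp add: cscale_diff_left algebra_simps)
  then have "cscale (z0 - lam) (R z0 u) + R z0 v = u"
    using u v by (simp add: R_add[OF z0] R_cscale[OF z0] HD)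
  then have "cscale \<kappa> u = cscale \<kappa> (cscale (z0 - lam) (R z0 u) + R z0 v)" by simp
  then show "E u = cscale \<kappa> (R z0 v)"
    using lam by (simp add: E_def cscale_add_right)
qed

lemma R_in_domain:
  assumes "v \<in> H"
  shows "\<exists>w. (R z0 v, w) \<in> op_shift lam T"
proof -
  have "(R z0 v, cscale lam (R z0 v) - (cscale lam (R z0 v) - (cscale z0 (R z0 v) - v))) \<in> T"
    using resolvent_graph[OF z0 assms] by simp
  then show ?thesis using op_shift_iff[of _ _ lam T] by blast
qed

lemma shift_linear:
  assumes "(u, v) \<in> op_shift lam T" "(u', v') \<in> op_shift lam T"
  shows "(cscale c u + cscale d u', cscale c v + cscale d v') \<in> op_shift lam T"
  using linear_relationD(2)[OF T linear_relationD(3)[OF T assms(1)[unfolded op_shift_iff], of c]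
      linear_relationD(3)[OF T assms(2)[unfolded op_shift_iff], of d]]
  by (simp add: op_shift_iff cscale_diff_right cscale_add_right algebra_simps)

lemma R_eq_0:
  assumes "v \<in> H" "R z0 v = 0"
  shows "v = 0"
  using resolvent_graph[OF z0 assms(1)] linear_relationD(1)[OF T] single_valuedD[OF T_single, of 0 0 "- v"]
  by (simp add: assms(2))

text \<open>By \<open>E_resolvent\<close>, \<open>E\<close> is lam - T followed by a multiple of
  \<open>R z0\<close>, which is injective and commutes with \<open>E\<close>; hence kernels agree
  level by level. The delicate point is that a vector of \<open>gker (Suc k)\<close> must first be
  shown to lie in the domain of T.\<close>

lemma null_space_power: "null_space (op_shift lam T ^^ k) = gker k"
proof (induction k)
  case 0
  show ?case using HD(1) by (auto simp: null_space_def gker_def)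
next
  case (Suc k)
  have step: "u \<in> null_space (op_shift lam T ^^ Suc k) \<longleftrightarrow> (\<exists>v. (u, v) \<in> op_shift lam T \<and> v \<in> gker k)"
    if "null_space (op_shift lam T ^^ k) = gker k" for u k
    unfolding that[symmetric] null_space_def relpow.simps(2) relpow_commute[symmetric] by auto
  have "u \<in> gker (Suc k)" if uv: "(u, v) \<in> op_shift lam T" and v: "v \<in> gker k" for u v
    using gkerD(3)[OF K_gker[OF v], of \<kappa>] E_resolvent[OF uv] E_gker by metis
  moreover have "\<exists>v. (u, v) \<in> op_shift lam T \<and> v \<in> gker k" if u: "u \<in> gker (Suc k)" for u
  proof -
    have uH: "u \<in> H" by (rule gker_H[OF u])
    have Eu: "E u \<in> gker k" using u uH E_gker by blast
    \<comment> \<open>As u = \<kappa>^-1 (E u + R z0 u) and \<open>R z0\<close> maps into the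
      domain, it suffices that \<open>E u\<close> is in the domain. It is zero for k = 0; otherwise
      the induction hypothesis puts it into the domain of a positive power of lam - T.\<close>
    have "\<exists>w. (E u, w) \<in> op_shift lam T"
    proof (cases k)
      case 0
      then have "E u = 0" using Eu by (simp add: gker_def)
      then show ?thesis using shift_linear linear_relationD(1)[OF T] op_shift_iff[of 0 0 lam T] by auto
    next
      case (Suc j)
      then have "(E u, 0) \<in> op_shift lam T O op_shift lam T ^^ j"
        using Eu Suc.IH by (simp add: null_space_def relpow_commute set_eq_iff)
      then show ?thesis by blast
    qed
    then obtain w where w: "(E u, w) \<in> op_shift lam T" by blast
    obtain w' where w': "(R z0 u, w') \<in> op_shift lam T" using R_in_domain[OF uH] by blast
    have "cscale (1 / \<kappa>) (E u) + cscale (1 / \<kappa>) (R z0 u) = cscale (1 / \<kappa>) (E u + R z0 u)"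
      by (simp only: cscale_add_right)
    also have "\<dots> = u" using lam by (simp add: E_def)
    finally obtain v where v: "(u, v) \<in> op_shift lam T"
      using shift_linear[OF w w', of "1 / \<kappa>" "1 / \<kappa>"] by metis
    note vE = E_resolvent[OF v]
    have "cscale (1 / \<kappa>) (cscale \<kappa> (R z0 v)) \<in> gker k"
      using gkerD(3)[OF Eu, of "1 / \<kappa>"] by (simp only: vE(3))
    then have "R z0 v \<in> gker k" using lam by simp
    then have "R z0 ((E ^^ k) v) = 0" using vE(2) by (simp add: gker_def Epow_K)
    then have "v \<in> gker k" using R_eq_0[OF Epow_in[OF vE(2)]] vE(2) by (simp add: gker_def)
    then show ?thesis using v by blast
  qed
  ultimately show ?case using step[OF Suc.IH] by blast
qed

text \<open>Stabilization is what makes the \<open>LEAST\<close> in \<open>eigenvalue_index\<close>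
  attained; otherwise the index would be an unspecified number.\<close>

lemma gker_index: "gker (eigenvalue_index T lam) = gker (Suc (eigenvalue_index T lam))"
proof -
  have "\<exists>m. null_space (op_shift lam T ^^ m) = null_space (op_shift lam T ^^ (m + 1))"
    using gker_stabilizes unfolding null_space_power by simp
  from LeastI_ex[OF this] show ?thesis
    unfolding eigenvalue_index_def null_space_power by simp
qed

text \<open>For v = R z f the resolvent identity gives ((z0 - z)^-1 - R z0) v = (z0 - z)^-1 R z0 f.
  Writing (z0 - z)^-1 = \<kappa> + \<sigma> brings this into the form of
  \<open>inverse_growth\<close>, and |\<sigma>| is comparable to |z - lam|, so the exponent carries
  over.\<close>

lemma resolvent_growth:
  "\<exists>C>0. \<exists>\<delta>>0. \<forall>z\<in>\<rho>. cmod (z - lam) < \<delta> \<longrightarrow>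
    (\<forall>f\<in>H. cmod (z - lam) ^ eigenvalue_index T lam * norm (R z f) \<le> C * norm f)"
proof -
  define m where "m = eigenvalue_index T lam"
  obtain C \<delta> where C: "C > 0" "\<delta> > 0" and grow: "\<And>\<sigma> v. cmod \<sigma> < \<delta> \<Longrightarrow> v \<in> H \<Longrightarrow>
      cmod \<sigma> ^ m * norm v \<le> C * norm (cscale (\<kappa> + \<sigma>) v - R z0 v)"
    using inverse_growth[OF gker_index] unfolding m_def by blast
  obtain D where D: "D > 0" "\<And>u. u \<in> H \<Longrightarrow> norm (R z0 u) \<le> D * norm u" using K_bound by blast
  define p where "p = cmod (z0 - lam)"
  have p: "p > 0" using lam by (simp add: p_def)
  \<comment> \<open>The first bound keeps |z0 - z| between p/2 and 2 p; with it, the second makes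
    |\<sigma>| smaller than \<delta>.\<close>
  define \<epsilon> where "\<epsilon> = min (p / 2) (\<delta> * p\<^sup>2 / 2)"
  define A where "A = (2 * p\<^sup>2) ^ m * (C * (2 / p * D))"
  have "cmod (z - lam) ^ m * norm (R z f) \<le> A * norm f"
    if z: "z \<in> \<rho>" "cmod (z - lam) < \<epsilon>" and f: "f \<in> H" for z f
  proof -
    define q where "q = cmod (z0 - z)"
    define s where "s = cmod (z - lam)"
    have s: "s < p / 2" "s < \<delta> * p\<^sup>2 / 2" "s \<ge> 0" using z(2) by (auto simp: s_def \<epsilon>_def)
    have q: "q > p / 2" "q < 2 * p"
      using s norm_triangle_ineq[of "z0 - z" "z - lam"] norm_triangle_ineq4[of "z0 - lam" "z - lam"]
      by (auto simp: q_def p_def s_def)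
    have zz: "z0 \<noteq> z" using q p by (auto simp: q_def)
    define \<sigma> where "\<sigma> = 1 / (z0 - z) - \<kappa>"
    have "\<sigma> = (z - lam) / ((z0 - z) * (z0 - lam))"
      using zz lam by (simp add: \<sigma>_def field_simps)
    then have \<sigma>: "cmod \<sigma> = s / (q * p)"
      by (simp add: norm_divide norm_mult s_def q_def p_def)
    have "s / (q * p) \<le> s / (p / 2 * p)"
      using q p s by (intro divide_left_mono mult_right_mono) auto
    also have "\<dots> < \<delta>" using s p by (simp add: field_simps power2_eq_square)
    finally have small: "cmod \<sigma> < \<delta>" by (simp add: \<sigma>)
    have "q * p \<le> 2 * p\<^sup>2" using q p by (simp add: power2_eq_square)
    then have large: "s \<le> 2 * p\<^sup>2 * cmod \<sigma>"
      using p q s mult_right_mono[of "q * p" "2 * p\<^sup>2" s] by (simp add: \<sigma> field_simps)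
    define v where "v = R z f"
    have v: "v \<in> H" unfolding v_def by (rule R_in[OF z(1) f])
    have "R z0 f = v - cscale (z0 - z) (R z0 v)"
      using resolvent_identity[OF z0 z(1) f] cscale_simps(6)[of "z0 - z" "R z0 (R z f)"]
      by (simp add: v_def algebra_simps)
    then have "cscale (1 / (z0 - z)) (R z0 f) = cscale (1 / (z0 - z)) v - R z0 v"
      using zz by (simp add: cscale_diff_right)
    then have "cscale (\<kappa> + \<sigma>) v - R z0 v = cscale (1 / (z0 - z)) (R z0 f)"
      by (simp add: \<sigma>_def)
    then have "norm (cscale (\<kappa> + \<sigma>) v - R z0 v) = 1 / q * norm (R z0 f)"
      by (simp add: norm_divide q_def)
    also have "\<dots> \<le> 2 / p * (D * norm f)"
      using q p D(2)[OF f] by (intro mult_mono) (auto simp: field_simps)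
    finally have b: "norm (cscale (\<kappa> + \<sigma>) v - R z0 v) \<le> 2 / p * (D * norm f)" .
    have "s ^ m * norm v \<le> (2 * p\<^sup>2 * cmod \<sigma>) ^ m * norm v"
      using large s by (intro mult_right_mono power_mono) auto
    also have "\<dots> = (2 * p\<^sup>2) ^ m * (cmod \<sigma> ^ m * norm v)" by (simp add: power_mult_distrib)
    also have "\<dots> \<le> (2 * p\<^sup>2) ^ m * (C * norm (cscale (\<kappa> + \<sigma>) v - R z0 v))"
      using grow[OF small v] by (intro mult_left_mono) auto
    also have "\<dots> \<le> (2 * p\<^sup>2) ^ m * (C * (2 / p * (D * norm f)))"
      using b C by (intro mult_left_mono) auto
    finally show ?thesis by (simp add: A_def s_def v_def algebra_simps)
  qed
  moreover have "A > 0" "\<epsilon> > 0" using p C D by (auto simp: A_def \<epsilon>_def)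
  ultimately show ?thesis unfolding m_def by blast
qed

end

subsection \<open>Compactness of the resolvent of \<open>DB\<close>\<close>

lemma inner_le_mult:
  fixes x y :: "'a::real_inner"
  assumes "norm x \<le> a" "norm y \<le> b"
  shows "inner x y \<le> a * b" "- inner x y \<le> a * b"
proof -
  have "norm x * norm y \<le> a * b"
    using assms norm_ge_zero[of x] by (intro mult_mono) (auto intro: order_trans[OF norm_ge_zero])
  then show "inner x y \<le> a * b" "- inner x y \<le> a * b"
    using Cauchy_Schwarz_ineq2[of x y] by linarith+
qed

locale accretive_DB = bounded_matrix_field \<Omega> B
  for \<Omega> :: "(real^'n) set" and B :: "real^'n \<Rightarrow> complex^'m^'m" +
  fixes D D1 :: "('n, 'm) op" and D0 :: "('n, 'm) L2 \<Rightarrow> ('n, 'm) L2" and zD :: complex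
  assumes accretive: "strictly_accretive \<Omega> B"
    and closed_range: "closed (Range D)"
    and D: "D = op_plus_bounded D1 D0"
    and D0: "bounded_operator_on (L2 \<Omega>) D0"
    and D1: "self_adjoint_in (L2 \<Omega>) D1"
    and zD: "zD \<in> resolvent_set (Range D) (op_restrict D (Range D))"
    and compact_D: "compact_operator_on (Range D) (resolvent (op_restrict D (Range D)) zD)"
begin

abbreviation H where "H \<equiv> Range D"
abbreviation T where "T \<equiv> op_T \<Omega> D B"
abbreviation G where "G \<equiv> resolvent (op_restrict D H) zD"

lemmas L2D = csubspaceD[OF csubspace_L2[where \<Omega> = \<Omega> and 'm = 'm]]

lemma D_iff: "(u, v) \<in> D \<longleftrightarrow> (u, v - D0 u) \<in> D1"
  by (auto simp: D op_plus_bounded_def) (metis diff_add_cancel)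

lemma D1_L2: "(u, v) \<in> D1 \<Longrightarrow> u \<in> L2 \<Omega> \<and> v \<in> L2 \<Omega>"
  and D1_linear: "linear_relation D1"
  and D1_single: "single_valued D1"
  using D1 by (auto simp: self_adjoint_in_def operator_in_def linear_relation_def)

lemma D0_in: "u \<in> L2 \<Omega> \<Longrightarrow> D0 u \<in> L2 \<Omega>"
  and D0_add: "u \<in> L2 \<Omega> \<Longrightarrow> v \<in> L2 \<Omega> \<Longrightarrow> D0 (u + v) = D0 u + D0 v"
  and D0_cscale: "u \<in> L2 \<Omega> \<Longrightarrow> D0 (cscale c u) = cscale c (D0 u)"
  using D0 by (auto simp: bounded_operator_on_def)

lemma D_L2:
  assumes "(u, v) \<in> D"
  shows "u \<in> L2 \<Omega>" "v \<in> L2 \<Omega>"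
proof -
  have *: "(u, v - D0 u) \<in> D1" using assms by (simp add: D_iff)
  show "u \<in> L2 \<Omega>" using D1_L2[OF *] by simp
  then show "v \<in> L2 \<Omega>" using D1_L2[OF *] L2D(2)[of "v - D0 u" "D0 u"] D0_in by simp
qed

lemma D_linear: "linear_relation D"
  unfolding linear_relation_def
proof (intro conjI allI impI)
  show "(0, 0) \<in> D"
    using linear_relationD(1)[OF D1_linear] D0_cscale[of 0 0] L2D(1) by (simp add: D_iff)
  show "(u + u', v + v') \<in> D" if "(u, v) \<in> D \<and> (u', v') \<in> D" for u v u' v'
  proof -
    have L: "u \<in> L2 \<Omega>" "u' \<in> L2 \<Omega>" using that D_L2 by blast+
    have "(u + u', (v - D0 u) + (v' - D0 u')) \<in> D1"
      using that by (intro linear_relationD(2)[OF D1_linear]) (auto simp: D_iff)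
    also have "(v - D0 u) + (v' - D0 u') = v + v' - D0 (u + u')" by (simp add: D0_add[OF L])
    finally show ?thesis by (simp add: D_iff)
  qed
  show "(cscale c u, cscale c v) \<in> D" if "(u, v) \<in> D" for c u v
    using that linear_relationD(3)[OF D1_linear, of u "v - D0 u" c] D_L2
    by (simp add: D_iff[of "cscale c u"] D0_cscale) (simp add: D_iff cscale_diff_right)
qed

lemma D_single: "single_valued D"
proof (rule single_valuedI)
  fix u v v' assume "(u, v) \<in> D" "(u, v') \<in> D"
  then have "v - D0 u = v' - D0 u"
    using single_valuedD[OF D1_single, of u "v - D0 u" "v' - D0 u"] by (simp add: D_iff)
  then show "v = v'" by simp
qed

lemma H_L2: "u \<in> H \<Longrightarrow> u \<in> L2 \<Omega>"
  using D_L2 by auto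

lemma csubspace_H: "csubspace H"
  using linear_relationD[OF D_linear] by (auto simp: csubspace_def) blast+

lemma T_iff: "(u, t) \<in> T \<longleftrightarrow> u \<in> H \<and> (M u, t) \<in> D"
  using H_L2 by (auto simp: op_T_def op_restrict_def op_DB_def op_times_bounded_def)

sublocale linear_operator_in H T
proof
  show "csubspace H" by (rule csubspace_H)
  show "closed H" by (rule closed_range)
  show "T \<subseteq> H \<times> H" using T_iff by auto
  have "M 0 = 0" using M_cscale[of 0 0] by simp
  then show "linear_relation T"
    using linear_relationD[OF D_linear] csubspaceD[OF csubspace_H]
    by (simp add: linear_relation_def T_iff M_add M_cscale)
  show "single_valued T"
    by (rule single_valuedI) (use single_valuedD[OF D_single] T_iff in blast)
qed

text \<open>Only the real part of the symmetry is kept, because it is combined with accretivity,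
  itself a statement about real parts.\<close>

lemma D1_symmetric: "(x, y) \<in> D1 \<Longrightarrow> (u, v) \<in> D1 \<Longrightarrow> inner y u = inner x v"
proof -
  assume x: "(x, y) \<in> D1" and "(u, v) \<in> D1"
  then have "(u, v) \<in> adjoint_op (L2 \<Omega>) D1" using D1 by (simp add: self_adjoint_in_def)
  then have "cinner y u = cinner x v" using x by (auto simp: adjoint_op_def)
  then show ?thesis by (simp add: cinner_eq)
qed

lemma G_bounded: "bounded_operator_on H G"
  using compact_D by (simp add: compact_operator_on_def)

lemma G_graph:
  assumes "f \<in> H"
  shows "(G f, cscale zD (G f) - f) \<in> D"
  using resolvent_graph[OF zD assms] by (simp add: op_restrict_def)

text \<open>
  Since \<open>D\<close> differs from a self-adjoint operator by a bounded one, elements of \<open>N(D)\<close> and \<open>R(D)\<close>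
  are orthogonal up to terms that are controlled by \<open>G\<close>. Accretivity then bounds \<open>u\<close> by \<open>G u\<close> and
  \<open>G T u\<close>; this replaces the topological splitting that is available for self-adjoint \<open>D\<close>.
\<close>

lemma compactness_estimate:
  "\<exists>c>0. \<forall>(u, t)\<in>T. (norm u)\<^sup>2 \<le> c * (norm u + norm t) * (norm (G u) + norm (G t))"
proof -
  obtain \<beta> where \<beta>: "\<beta> > 0" "\<And>u. u \<in> L2 \<Omega> \<Longrightarrow> \<beta> * (norm u)\<^sup>2 \<le> inner (M u) u"
    using M_accretive[OF accretive] by blast
  obtain CM where CM: "CM > 0" "\<And>u. norm (M u) \<le> CM * norm u" using M_bound by blast
  obtain CG where CG: "CG > 0" "\<And>f. f \<in> H \<Longrightarrow> norm (G f) \<le> CG * norm f"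
    using resolvent_bound[OF zD] by blast
  obtain C0' where C0': "\<And>u. u \<in> L2 \<Omega> \<Longrightarrow> norm (D0 u) \<le> C0' * norm u"
    using D0 unfolding bounded_operator_on_def by blast
  define C0 where "C0 = \<bar>C0'\<bar>"
  have C0: "C0 \<ge> 0" by (simp add: C0_def)
  have D0b: "norm (D0 u) \<le> C0 * norm u" if "u \<in> L2 \<Omega>" for u
    unfolding C0_def by (intro order_trans[OF C0'[OF that]] mult_right_mono) auto
  define Z where "Z = cmod zD"
  define k where "k = CM + CG"
  \<comment> \<open>The 1 comes from the pairing of h with u; the terms with Z and C0 come, two
    each, from the zeroth order terms zD and \<open>D0\<close> in the symmetry relation.\<close>
  define c where "c = (1 + 2 * k * Z + 2 * C0 * k) / \<beta>"
  have "(norm u)\<^sup>2 \<le> c * (norm u + norm t) * (norm (G u) + norm (G t))" if ut: "(u, t) \<in> T" for u t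
  proof -
    have u: "u \<in> H" and t: "t \<in> H" and b: "(M u, t) \<in> D" using ut T_iff by auto
    \<comment> \<open>The sign gives D h = zD h + t. As D maps \<open>M u\<close> to t, the
      difference n = M u - h is almost in N(D): D n = - zD h.\<close>
    define h where "h = - G t"
    define n where "n = M u - h"
    define w where "w = G u"
    define S where "S = norm u + norm t"
    define W where "W = norm w + norm h"
    have hD: "(h, cscale zD h + t) \<in> D"
      using linear_relationD(3)[OF D_linear G_graph[OF t], of "- 1"] by (simp add: h_def algebra_simps)
    have nD: "(n, - cscale zD h) \<in> D"
      using linear_relationD(4)[OF D_linear b hD] by (simp add: n_def)
    have wD: "(w, cscale zD w - u) \<in> D" using G_graph[OF u] by (simp add: w_def)
    note nL = D_L2(1)[OF nD] and wL = D_L2(1)[OF wD]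
    \<comment> \<open>With w = G u, D w = zD w - u recovers u up to a small term. Moving
      \<open>D1\<close> from w to n then expresses the pairing of n with u through terms that all
      contain h or w, that is, \<open>G t\<close> or \<open>G u\<close>.\<close>
    have sym: "inner (- cscale zD h - D0 n) w = inner n (cscale zD w - u - D0 w)"
      using D1_symmetric[of n "- cscale zD h - D0 n" w "cscale zD w - u - D0 w"] nD wD
      by (simp add: D_iff)
    have S: "S \<ge> 0" and W: "W \<ge> 0" by (auto simp: S_def W_def)
    have k: "k > 0" using CM CG by (simp add: k_def)
    have n1: "norm n \<le> k * S"
    proof -
      have "norm n \<le> norm (M u) + norm (G t)"
        using norm_triangle_ineq4[of "M u" h] by (simp add: n_def h_def)
      also have "\<dots> \<le> CM * norm u + CG * norm t" using CM(2) CG(2)[OF t] by (intro add_mono)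
      also have "\<dots> \<le> k * S"
        using CM(1) CG(1) by (simp add: k_def S_def algebra_simps)
      finally show ?thesis .
    qed
    have h1: "norm h \<le> k * S"
    proof -
      have "norm h \<le> CG * norm t" using CG(2)[OF t] by (simp add: h_def)
      also have "\<dots> \<le> k * S" using CM(1) CG(1) by (intro mult_mono) (auto simp: k_def S_def)
      finally show ?thesis .
    qed
    have ZS: "norm (cscale zD h) \<le> Z * (k * S)"
      unfolding norm_cscale Z_def using h1 by (intro mult_left_mono) auto
    have ZW: "norm (cscale zD w) \<le> Z * W"
      unfolding norm_cscale Z_def by (intro mult_left_mono) (auto simp: W_def)
    have D0n: "norm (D0 n) \<le> C0 * (k * S)"
      using D0b[OF nL] mult_left_mono[OF n1 C0] by linarith
    have D0w: "norm (D0 w) \<le> C0 * W"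
      using D0b[OF wL] mult_left_mono[of "norm w" W C0] C0 by (simp add: W_def)
    have wW: "norm w \<le> W" and hW: "norm h \<le> W" and uS: "norm u \<le> S" by (auto simp: W_def S_def)
    have "\<beta> * (norm u)\<^sup>2 \<le> inner (M u) u" by (rule \<beta>(2)[OF H_L2[OF u]])
    also have "\<dots> = inner h u + inner n u" by (simp add: n_def inner_diff_left)
    also have "inner n u = inner n (cscale zD w) - inner n (D0 w) + inner (cscale zD h) w + inner (D0 n) w"
      using sym by (simp add: inner_diff_left inner_diff_right inner_minus_left)
    also have "inner h u + (inner n (cscale zD w) - inner n (D0 w) + inner (cscale zD h) w + inner (D0 n) w)
        \<le> W * S + (k * S * (Z * W) + k * S * (C0 * W) + Z * (k * S) * W + C0 * (k * S) * W)"
      using inner_le_mult[OF hW uS] inner_le_mult[OF n1 ZW] inner_le_mult[OF n1 D0w]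
        inner_le_mult[OF ZS wW] inner_le_mult[OF D0n wW] by linarith
    also have "\<dots> = \<beta> * (c * S * W)"
      using \<beta>(1) by (simp add: c_def field_simps)
    finally have "(norm u)\<^sup>2 \<le> c * S * W" using \<beta>(1) by simp
    then show ?thesis by (simp add: S_def W_def w_def h_def)
  qed
  moreover have "c > 0"
    using \<beta>(1) CM(1) CG(1) by (simp add: c_def k_def C0_def Z_def add_pos_nonneg)
  ultimately show ?thesis by blast
qed

text \<open>Along a subsequence both \<open>G (u k)\<close> and \<open>G (t k)\<close> converge,
  where t = T u. Applied to differences, the estimate has a bounded factor and a factor tending to
  zero, so the u themselves are Cauchy.\<close>

lemma compact_resolvent:
  assumes z: "z \<in> resolvent_set H T"
    and f: "range f \<subseteq> H" "bounded (range f)"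
  shows "\<exists>s l. strict_mono (s :: nat \<Rightarrow> nat) \<and> (\<lambda>k. resolvent T z (f (s k))) \<longlonglongrightarrow> l"
proof -
  obtain c where c: "c > 0" and est: "\<And>u t. (u, t) \<in> T \<Longrightarrow>
      (norm u)\<^sup>2 \<le> c * (norm u + norm t) * (norm (G u) + norm (G t))"
    using compactness_estimate by blast
  obtain C where C: "C > 0" "\<And>g. g \<in> H \<Longrightarrow> norm (R z g) \<le> C * norm g"
    using resolvent_bound[OF z] by blast
  obtain b where b: "b > 0" "\<And>k. norm (f k) \<le> b"
    using f(2) unfolding bounded_pos by auto
  have fH: "f k \<in> H" for k using f(1) by auto
  define u where "u k = R z (f k)" for k
  define t where "t k = cscale z (u k) - f k" for k
  have ut: "(u k, t k) \<in> T" for k unfolding u_def t_def by (rule resolvent_graph[OF z fH])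
  have uH: "u k \<in> H" and tH: "t k \<in> H" for k using ut[of k] T_sub by auto
  have ub: "norm (u k) \<le> C * b" for k
    unfolding u_def using C(1) by (intro order_trans[OF C(2)[OF fH]] mult_left_mono b(2)) simp
  have tb: "norm (t k) \<le> cmod z * (C * b) + b" for k
    using norm_triangle_ineq4[of "cscale z (u k)" "f k"] b(2)[of k]
      mult_left_mono[OF ub[of k], of "cmod z"] by (simp add: t_def)
  have "range u \<subseteq> H" "bounded (range u)" using uH ub by (auto simp: bounded_iff)
  from compact_operator_subseq[OF compact_D this]
  obtain s l where s: "strict_mono (s :: nat \<Rightarrow> nat)" and l: "(\<lambda>k. G (u (s k))) \<longlonglongrightarrow> l" by blast
  have "range (t \<circ> s) \<subseteq> H" "bounded (range (t \<circ> s))" using tH tb by (auto simp: bounded_iff)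
  from compact_operator_subseq[OF compact_D this]
  obtain s' l' where s': "strict_mono (s' :: nat \<Rightarrow> nat)" and l': "(\<lambda>k. G ((t \<circ> s) (s' k))) \<longlonglongrightarrow> l'" by blast
  define q where "q = s \<circ> s'"
  have q: "strict_mono q" unfolding q_def by (rule strict_mono_o[OF s s'])
  have Cu: "Cauchy (\<lambda>k. G (u (q k)))"
    using LIMSEQ_imp_Cauchy[OF LIMSEQ_subseq_LIMSEQ[OF l s']] by (simp add: q_def o_def)
  have Ct: "Cauchy (\<lambda>k. G (t (q k)))"
    using LIMSEQ_imp_Cauchy[OF l'] by (simp add: q_def)
  have G_diff: "G (x - y) = G x - G y" if "x \<in> H" "y \<in> H" for x y
  proof -
    have "G (x + cscale (- 1) y) = G x + cscale (- 1) (G y)"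
      using G_bounded that HD(3)[of y "- 1"] unfolding bounded_operator_on_def by metis
    then show ?thesis by simp
  qed
  \<comment> \<open>Bounds the factor c (|x| + |y|) for all differences x and y of the two
    sequences.\<close>
  define L where "L = c * (2 * (C * b) + 2 * (cmod z * (C * b) + b))"
  have L: "L > 0" using c C(1) b(1) by (auto simp: L_def intro!: mult_pos_pos add_pos_nonneg add_nonneg_pos)
  have "Cauchy (\<lambda>k. u (q k))"
  proof (rule CauchyI)
    fix e :: real assume e: "e > 0"
    \<comment> \<open>Chosen so that L (d + d) is exactly the square of e.\<close>
    define d where "d = e\<^sup>2 / (2 * L)"
    have d: "d > 0" using e L by (simp add: d_def)
    obtain N1 where N1: "\<And>i j. i \<ge> N1 \<Longrightarrow> j \<ge> N1 \<Longrightarrow> norm (G (u (q i)) - G (u (q j))) < d"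
      using CauchyD[OF Cu d] by blast
    obtain N2 where N2: "\<And>i j. i \<ge> N2 \<Longrightarrow> j \<ge> N2 \<Longrightarrow> norm (G (t (q i)) - G (t (q j))) < d"
      using CauchyD[OF Ct d] by blast
    have "norm (u (q i) - u (q j)) < e" if ij: "i \<ge> max N1 N2" "j \<ge> max N1 N2" for i j
    proof -
      define x where "x = u (q i) - u (q j)"
      define y where "y = t (q i) - t (q j)"
      have "(x, y) \<in> T" unfolding x_def y_def by (rule linear_relationD(4)[OF T ut ut])
      then have "(norm x)\<^sup>2 \<le> c * (norm x + norm y) * (norm (G x) + norm (G y))" by (rule est)
      also have "\<dots> \<le> L * (norm (G x) + norm (G y))"
      proof (intro mult_right_mono)
        have "norm x \<le> 2 * (C * b)"
          using norm_triangle_ineq4[of "u (q i)" "u (q j)"] ub[of "q i"] ub[of "q j"] by (simp add: x_def)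
        moreover have "norm y \<le> 2 * (cmod z * (C * b) + b)"
          using norm_triangle_ineq4[of "t (q i)" "t (q j)"] tb[of "q i"] tb[of "q j"] by (simp add: y_def)
        ultimately show "c * (norm x + norm y) \<le> L"
          unfolding L_def using c by (intro mult_left_mono) auto
      qed auto
      also have "\<dots> < L * (d + d)"
      proof (intro mult_strict_left_mono add_strict_mono)
        show "norm (G x) < d" using N1[of i j] ij by (simp add: x_def G_diff uH)
        show "norm (G y) < d" using N2[of i j] ij by (simp add: y_def G_diff tH)
      qed (rule L)
      also have "\<dots> = e\<^sup>2" using L by (simp add: d_def)
      finally show ?thesis using e by (auto simp: x_def intro: power2_less_imp_less)
    qed
    then show "\<exists>N. \<forall>i\<ge>N. \<forall>j\<ge>N. norm (u (q i) - u (q j)) < e" by blast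
  qed
  then obtain l'' where "(\<lambda>k. u (q k)) \<longlonglongrightarrow> l''"
    using Cauchy_convergent convergent_def by blast
  then show ?thesis using q by (auto simp: u_def)
qed

end

subsection \<open>Contour integrals around the eigenvalue\<close>

text \<open>Multiplication by (z - lam)^(k+1) turns f into a function g holomorphic on the whole
  disc. The integral becomes a multiple of the k-th derivative of h g at lam, whatever r is, and the
  derivatives of g are estimated on a small circle where A controls f. Hence the constant depends on
  none of f, h, r and A.\<close>

lemma contour_integral_pole_bound:
  fixes lam :: complex
  assumes "\<delta> > 0" "rad > 0"
  shows "\<exists>C>0. \<forall>f h r A I. f holomorphic_on ball lam rad - {lam} \<and>
     (\<forall>z. z \<noteq> lam \<and> cmod (z - lam) < min \<delta> rad \<longrightarrow> cmod (z - lam) ^ Suc k * cmod (f z) \<le> A) \<and>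
     h holomorphic_on ball lam rad \<and> 0 < r \<and> r < rad \<and>
     ((\<lambda>z. h z * f z) has_contour_integral I) (circlepath lam r) \<longrightarrow>
     cmod I \<le> C * A * Max ((\<lambda>j. cmod ((deriv ^^ j) h lam)) ` {0..k})"
proof -
  \<comment> \<open>Half the minimum, so that the circle of radius d lies strictly inside the region
    where the bound A holds.\<close>
  define d where "d = min \<delta> rad / 2"
  have d: "0 < d" "d < \<delta>" "d < rad" using assms by (auto simp: d_def min_def)
  define C where "C = 2 * pi * (\<Sum>i=0..k. real (k choose i) * (fact (k - i) / d ^ (k - i)))"
  have "(\<Sum>i=0..k. real (k choose i) * (fact (k - i) / d ^ (k - i))) > 0"
    using d(1) by (intro sum_pos) auto
  then have C: "C > 0" by (simp add: C_def)
  have "cmod I \<le> C * A * Max ((\<lambda>j. cmod ((deriv ^^ j) h lam)) ` {0..k})"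
    if f: "f holomorphic_on ball lam rad - {lam}"
      and A: "\<forall>z. z \<noteq> lam \<and> cmod (z - lam) < min \<delta> rad \<longrightarrow> cmod (z - lam) ^ Suc k * cmod (f z) \<le> A"
      and h: "h holomorphic_on ball lam rad" and r: "0 < r" "r < rad"
      and I: "((\<lambda>z. h z * f z) has_contour_integral I) (circlepath lam r)" for f h r A I
  proof -
    define Mx where "Mx = Max ((\<lambda>j. cmod ((deriv ^^ j) h lam)) ` {0..k})"
    have Mx: "cmod ((deriv ^^ j) h lam) \<le> Mx" if "j \<le> k" for j
      unfolding Mx_def using that by (intro Max_ge) auto
    have Mx0: "Mx \<ge> 0" using Mx[of 0] norm_ge_zero by (rule order_trans[rotated]) simp
    have "\<forall>\<^sub>F z in at lam. cmod ((z - lam) ^ Suc k * f z) \<le> A"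
      unfolding eventually_at
      using A assms by (intro exI[of _ "min \<delta> rad"]) (auto simp: norm_mult norm_power dist_norm)
    moreover have "(\<lambda>z. (z - lam) ^ Suc k * f z) holomorphic_on ball lam rad - {lam}"
      by (intro holomorphic_intros f)
    \<comment> \<open>Riemann's theorem on removable singularities.\<close>
    ultimately obtain g where g: "g holomorphic_on ball lam rad"
      and gf: "\<And>z. z \<in> ball lam rad - {lam} \<Longrightarrow> g z = (z - lam) ^ Suc k * f z"
      using holomorphic_on_extend_bounded[of "\<lambda>z. (z - lam) ^ Suc k * f z" "ball lam rad" lam] assms(2)
      by auto
    have gd: "cmod ((deriv ^^ n) g lam) \<le> fact n * A / d ^ n" for n
    proof (rule Cauchy_inequality)
      show "g holomorphic_on ball lam d"
        by (rule holomorphic_on_subset[OF g]) (use d in auto)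
      show "continuous_on (cball lam d) g"
        by (rule continuous_on_subset[OF holomorphic_on_imp_continuous_on[OF g]]) (use d in auto)
      fix x assume x: "cmod (lam - x) = d"
      then have "x \<noteq> lam" "x \<in> ball lam rad - {lam}" using d by (auto simp: dist_norm)
      then show "cmod (g x) \<le> A"
        using A x d gf[of x] by (auto simp: norm_mult norm_power norm_minus_commute)
    qed (rule d(1))
    have "cmod (g lam) \<le> A" using gd[of 0] by simp
    then have A0: "A \<ge> 0" by (rule order_trans[OF norm_ge_zero])
    have "((\<lambda>u. h u * g u / (u - lam) ^ Suc k) has_contour_integral
        (2 * pi * \<i>) / fact k * (deriv ^^ k) (\<lambda>z. h z * g z) lam) (circlepath lam r)"
    proof (rule Cauchy_has_contour_integral_higher_derivative_circlepath)
      have hg: "(\<lambda>z. h z * g z) holomorphic_on ball lam rad" by (intro holomorphic_intros h g)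
      show "continuous_on (cball lam r) (\<lambda>z. h z * g z)"
        by (rule continuous_on_subset[OF holomorphic_on_imp_continuous_on[OF hg]]) (use r in auto)
      show "(\<lambda>z. h z * g z) holomorphic_on ball lam r"
        by (rule holomorphic_on_subset[OF hg]) (use r in auto)
    qed (use r in simp)
    then have "((\<lambda>z. h z * f z) has_contour_integral
        (2 * pi * \<i>) / fact k * (deriv ^^ k) (\<lambda>z. h z * g z) lam) (circlepath lam r)"
    proof (rule has_contour_integral_eq)
      fix x assume "x \<in> path_image (circlepath lam r)"
      then have "x \<noteq> lam" "x \<in> ball lam rad - {lam}" using r by (auto simp: dist_norm)
      then show "h x * g x / (x - lam) ^ Suc k = h x * f x" using gf by simp
    qed
    then have "I = (2 * pi * \<i>) / fact k * (deriv ^^ k) (\<lambda>z. h z * g z) lam"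
      by (rule has_contour_integral_unique[OF I])
    then have "cmod I = 2 * pi / fact k * cmod ((deriv ^^ k) (\<lambda>z. h z * g z) lam)"
      by (simp add: norm_mult norm_divide)
    also have "\<dots> \<le> 2 * pi * cmod ((deriv ^^ k) (\<lambda>z. h z * g z) lam)"
      by (intro mult_right_mono) (auto simp: divide_le_eq fact_ge_1)
    also have "(deriv ^^ k) (\<lambda>z. h z * g z) lam =
        (\<Sum>i=0..k. of_nat (k choose i) * (deriv ^^ i) h lam * (deriv ^^ (k - i)) g lam)"
      by (rule higher_deriv_mult[OF h g open_ball]) (use assms in simp)
    also have "cmod \<dots> \<le> (\<Sum>i=0..k. (real (k choose i) * (fact (k - i) / d ^ (k - i))) * (A * Mx))"
    proof (rule sum_norm_le)
      fix i assume "i \<in> {0..k}"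
      then have "cmod ((deriv ^^ i) h lam) * cmod ((deriv ^^ (k - i)) g lam) \<le> Mx * (fact (k - i) * A / d ^ (k - i))"
        by (intro mult_mono Mx gd Mx0) auto
      then have "real (k choose i) * (cmod ((deriv ^^ i) h lam) * cmod ((deriv ^^ (k - i)) g lam))
          \<le> real (k choose i) * (Mx * (fact (k - i) * A / d ^ (k - i)))"
        by (intro mult_left_mono) auto
      then show "cmod (of_nat (k choose i) * (deriv ^^ i) h lam * (deriv ^^ (k - i)) g lam)
          \<le> (real (k choose i) * (fact (k - i) / d ^ (k - i))) * (A * Mx)"
        by (simp add: norm_mult algebra_simps)
    qed
    also have "2 * pi * (\<Sum>i=0..k. (real (k choose i) * (fact (k - i) / d ^ (k - i))) * (A * Mx)) = C * A * Mx"
      unfolding C_def sum_distrib_right[symmetric] by simp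
    finally show ?thesis by (simp add: Mx_def)
  qed
  then show ?thesis using C by blast
qed

context eigenvalue_compact_resolvent
begin

text \<open>A curve integral that does not exist has the value \<open>0\<close>, so integrability need not be shown.\<close>

lemma circle_integral_bound:
  assumes rad: "rad > 0" and sub: "ball lam rad - {lam} \<subseteq> \<rho>"
  shows "\<exists>C>0. \<forall>h r u. h holomorphic_on ball lam rad \<and> 0 < r \<and> r < rad \<and> u \<in> H \<longrightarrow>
    norm (curve_integral {0..1} (circlepath lam r) (\<lambda>z. cscale (h z) (R z u)))
      \<le> C * norm u * Max ((\<lambda>j. cmod ((deriv ^^ j) h lam)) ` {0..eigenvalue_index T lam - 1})"
proof -
  define m where "m = eigenvalue_index T lam"
  obtain C1 \<delta> where C1: "C1 > 0" "\<delta> > 0" and grow: "\<And>z f. z \<in> \<rho> \<Longrightarrow> cmod (z - lam) < \<delta> \<Longrightarrow> f \<in> H \<Longrightarrow>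
      cmod (z - lam) ^ m * norm (R z f) \<le> C1 * norm f"
    using resolvent_growth unfolding m_def by blast
  \<comment> \<open>The subtraction in \<open>m - 1\<close> is truncated, so
    \<open>Suc (m - 1)\<close> is m or, for m = 0, one more. Restricting to |z - lam| < 1 makes the
    growth bound with exponent m imply the one needed here.\<close>
  obtain C2 where C2: "C2 > 0" and pole: "\<And>f h r A I. f holomorphic_on ball lam rad - {lam} \<Longrightarrow>
     (\<forall>z. z \<noteq> lam \<and> cmod (z - lam) < min (min \<delta> 1) rad \<longrightarrow> cmod (z - lam) ^ Suc (m - 1) * cmod (f z) \<le> A) \<Longrightarrow>
     h holomorphic_on ball lam rad \<Longrightarrow> 0 < r \<Longrightarrow> r < rad \<Longrightarrow>
     ((\<lambda>z. h z * f z) has_contour_integral I) (circlepath lam r) \<Longrightarrow>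
     cmod I \<le> C2 * A * Max ((\<lambda>j. cmod ((deriv ^^ j) h lam)) ` {0..m - 1})"
    using contour_integral_pole_bound[of "min \<delta> 1" rad lam "m - 1"] C1(2) rad by auto
  have "norm (curve_integral {0..1} (circlepath lam r) (\<lambda>z. cscale (h z) (R z u)))
      \<le> (C2 * (2 * C1)) * norm u * Max ((\<lambda>j. cmod ((deriv ^^ j) h lam)) ` {0..m - 1})"
    if h: "h holomorphic_on ball lam rad" and r: "0 < r" "r < rad" and u: "u \<in> H" for h r u
  proof -
    define Mx where "Mx = Max ((\<lambda>j. cmod ((deriv ^^ j) h lam)) ` {0..m - 1})"
    have "cmod ((deriv ^^ j) h lam) \<le> Mx" if "j \<le> m - 1" for j
      unfolding Mx_def using that by (intro Max_ge) auto
    from this[of 0] have Mx0: "Mx \<ge> 0" by (intro order_trans[OF norm_ge_zero]) simp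
    define g where "g t = cscale (vector_derivative (circlepath lam r) (at t within {0..1}))
        (cscale (h (circlepath lam r t)) (R (circlepath lam r t) u))" for t
    define v where "v = integral {0..1} g"
    have v: "curve_integral {0..1} (circlepath lam r) (\<lambda>z. cscale (h z) (R z u)) = v"
      by (simp add: curve_integral_def v_def g_def[abs_def])
    have "norm v \<le> (C2 * (2 * C1)) * norm u * Mx"
    proof (cases "g integrable_on {0..1}")
      case False
      then show ?thesis using C1 C2 Mx0 by (simp add: v_def not_integrable_integral)
    next
      case True
      then have "(g has_integral v) {0..1}" by (simp add: v_def integrable_integral)
      \<comment> \<open>The test vector is the integral v itself: the scalar integral dominates the
        square of the norm of v, while the bound on the integrand is linear in that norm, so one
        factor cancels.\<close>
      from has_integral_linear[OF this bounded_linear_cinner_left[of v]]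
      have "((\<lambda>z. h z * cinner (R z u) v) has_contour_integral cinner v v) (circlepath lam r)"
        by (simp add: has_contour_integral_def o_def g_def cinner_cscale_left mult.commute mult.left_commute)
      moreover have "cmod (z - lam) ^ Suc (m - 1) * cmod (cinner (R z u) v) \<le> 2 * norm v * (C1 * norm u)"
        if z: "z \<noteq> lam \<and> cmod (z - lam) < min (min \<delta> 1) rad" for z
      proof -
        have zr: "z \<in> \<rho>" using z sub by (auto simp: dist_norm norm_minus_commute)
        have "cmod (z - lam) ^ Suc (m - 1) * cmod (cinner (R z u) v)
            \<le> cmod (z - lam) ^ m * (2 * norm v * norm (R z u))"
          using z by (intro mult_mono power_decreasing norm_cinner_le) auto
        also have "\<dots> = 2 * norm v * (cmod (z - lam) ^ m * norm (R z u))" by simp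
        also have "\<dots> \<le> 2 * norm v * (C1 * norm u)"
          using grow[OF zr _ u] z by (intro mult_left_mono) auto
        finally show ?thesis .
      qed
      ultimately have "cmod (cinner v v) \<le> C2 * (2 * norm v * (C1 * norm u)) * Mx"
        unfolding Mx_def by (intro pole[OF resolvent_holomorphic[OF sub u] _ h r]) auto
      then have "norm v * norm v \<le> norm v * ((C2 * (2 * C1)) * norm u * Mx)"
        using norm_le_cinner[of v] by (simp add: power2_eq_square algebra_simps)
      then show ?thesis
        using C1 C2 Mx0 by (cases "v = 0") (auto simp: mult_le_cancel_left)
    qed
    then show ?thesis by (simp add: v Mx_def)
  qed
  moreover have "C2 * (2 * C1) > 0" using C1 C2 by simp
  ultimately show ?thesis unfolding m_def by blast
qed

end

section \<open>The functional calculus for functions supported in one disc\<close>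

lemma accretivity_angle_nonneg:
  fixes B :: "real^'n \<Rightarrow> complex^'m^'m"
  shows "accretivity_angle \<Omega> B \<ge> 0"
proof -
  define f where "f x = (SUP v\<in>-{0}. ereal \<bar>Arg (hdot (B x *v v) v)\<bar>)" for x
  have f0: "f x \<ge> 0" for x
    unfolding f_def by (rule SUP_upper2[of "1 :: complex^'m"]) auto
  have "real_of_ereal (esssup (lebesgue_on \<Omega>) f) \<ge> 0"
  \<comment> \<open>For non-measurable \<open>f\<close>, \<open>esssup\<close> is infinite by
    default, and over a null space the \<open>Limsup\<close> is minus infinity;
    \<open>real_of_ereal\<close> sends both to 0.\<close>
  proof (cases "f \<in> borel_measurable (lebesgue_on \<Omega>) \<and> ae_filter (lebesgue_on \<Omega>) \<noteq> bot")
    case True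
    have "0 = Limsup (ae_filter (lebesgue_on \<Omega>)) (\<lambda>x. 0 :: ereal)"
      using True by (simp add: Limsup_const)
    also have "\<dots> \<le> Limsup (ae_filter (lebesgue_on \<Omega>)) f"
      by (intro Limsup_mono always_eventually) (simp add: f0)
    finally show ?thesis using True by (simp add: esssup_def real_of_ereal_pos)
  next
    case False
    then show ?thesis by (auto simp: esssup_def bot_ereal_def top_ereal_def)
  qed
  then show ?thesis by (simp add: accretivity_angle_def f_def[abs_def])
qed

lemma curve_integral_eq_0:
  assumes "\<And>t. t \<in> I \<Longrightarrow> F (g t) = 0"
  shows "curve_integral I g F = 0"
  unfolding curve_integral_def by (subst integral_cong[where g = "\<lambda>_. 0"]) (auto simp: assms)

theorem proposition3p15:
  fixes \<Omega> :: "(real^'n) set"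
    and B :: "real^'n \<Rightarrow> complex^'m^'m"
    and D T :: "('n, 'm) op"
    and H :: "('n, 'm) L2 set"
    and \<omega> \<tau> a R \<mu> :: real
    and N i :: nat
    and lam :: "nat \<Rightarrow> complex"
    and \<Sigma> :: "complex set"
  assumes "weakly_lipschitz_domain \<Omega>"
    and "L_infinity \<Omega> B" and "strictly_accretive \<Omega> B"
    and "admissible_D \<Omega> D"
    and H: "H = Range D" and T: "T = op_T \<Omega> D B"
    and \<omega>: "\<omega> = accretivity_angle \<Omega> B"
    and "\<tau> > 0"
    and "spectrum (L2 \<Omega>) (op_DB \<Omega> D B) \<subseteq> S_open \<omega> \<tau>"
    and "\<exists>C. \<forall>z. z \<notin> S_open \<omega> \<tau> \<longrightarrow>
           op_norm (L2 \<Omega>) (resolvent (op_DB \<Omega> D B) z) \<le> ereal (C / infdist z (S_closed \<omega>))"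
    and "inj_on lam {1..N}"
    and "lam ` {1..N} = {z \<in> eigenvalues T. Re z = 0}"
    and "0 < R" and "R < a"
    and "spectrum H T \<inter> {z. \<bar>Re z\<bar> \<le> a} = lam ` {1..N}"
    and "\<And>j k. j \<in> {1..N} \<Longrightarrow> k \<in> {1..N} \<Longrightarrow> j \<noteq> k \<Longrightarrow> cball (lam j) R \<inter> cball (lam k) R = {}"
    and "\<And>j. j \<in> {1..N} \<Longrightarrow> cball (lam j) R \<subseteq> S_open \<omega> \<tau>"
    and "\<omega> < \<mu>" and "\<mu> < pi / 2"
    and \<Sigma>: "\<Sigma> = Sigma_dom N lam R a \<tau> \<mu>"
    and "i \<in> {1..N}"
  shows "\<exists>C>0. \<forall>h \<in> H_infinity \<Sigma>.
           (\<forall>z\<in>\<Sigma>. z \<notin> {\<zeta>. cmod (lam i - \<zeta>) < R} \<longrightarrow> h z = 0) \<longrightarrow>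
           (\<forall>\<nu> r b. \<omega> < \<nu> \<and> \<nu> < \<mu> \<and> 0 < r \<and> r < R \<and> a < b \<and>
                    spectrum H T \<inter> {z. a \<le> \<bar>Re z\<bar> \<and> \<bar>Re z\<bar> \<le> b} = {} \<longrightarrow>
              op_norm H (functional_calculus N lam \<tau> r \<nu> b T h)
                \<le> ereal (C * Max ((\<lambda>j. cmod ((deriv ^^ j) h (lam i))) ` {0..eigenvalue_index T (lam i) - 1})))"
proof -
  have \<omega>0: "\<omega> \<ge> 0" unfolding \<omega> by (rule accretivity_angle_nonneg)
  obtain D1 D0 zD where "D = op_plus_bounded D1 D0" "bounded_operator_on (L2 \<Omega>) D0"
    "self_adjoint_in (L2 \<Omega>) D1" "zD \<in> resolvent_set (Range D) (op_restrict D (Range D))"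
    "compact_operator_on (Range D) (resolvent (op_restrict D (Range D)) zD)" "closed (Range D)"
    using \<open>admissible_D \<Omega> D\<close> unfolding admissible_D_def by blast
  then interpret DB: accretive_DB \<Omega> B D D1 D0 zD
    using assms(1-3) by unfold_locales (auto simp: weakly_lipschitz_domain_def)
  note spec = \<open>spectrum H T \<inter> {z. \<bar>Re z\<bar> \<le> a} = lam ` {1..N}\<close>
  have Re0: "Re (lam j) = 0" if "j \<in> {1..N}" for j
    using \<open>lam ` {1..N} = {z \<in> eigenvalues T. Re z = 0}\<close> that by blast
  have disj: "\<not> (z \<in> cball (lam j) R \<and> z \<in> cball (lam i) R)" if "j \<in> {1..N}" "j \<noteq> i" for j z
    using assms(16)[OF that(1) \<open>i \<in> {1..N}\<close> that(2)] by blast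
  \<comment> \<open>The centre is on the imaginary axis and R < a, so the disc avoids both unbounded
    components of \<Sigma>; there h must vanish.\<close>
  have small: "\<bar>Re z\<bar> \<le> a" if "z \<in> ball (lam i) R" for z
    using that abs_Re_le_cmod[of "z - lam i"] Re0[OF \<open>i \<in> {1..N}\<close>] \<open>R < a\<close>
    by (simp add: dist_norm norm_minus_commute)
  have sub: "ball (lam i) R - {lam i} \<subseteq> resolvent_set H T"
  proof
    fix z assume z: "z \<in> ball (lam i) R - {lam i}"
    show "z \<in> resolvent_set H T"
    proof (rule ccontr)
      assume "z \<notin> resolvent_set H T"
      then have "z \<in> lam ` {1..N}" using spec small[of z] z by (auto simp: spectrum_def)
      then obtain j where j: "j \<in> {1..N}" "z = lam j" by blast
      then show False using disj[of j z] z \<open>0 < R\<close> by auto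
    qed
  qed
  \<comment> \<open>Any point of the punctured disc would serve as base point for the compact
    operator.\<close>
  define z0 where "z0 = lam i + of_real (R / 2)"
  have z0: "z0 \<in> resolvent_set H T" "z0 \<noteq> lam i"
    using sub \<open>0 < R\<close> by (auto simp: z0_def dist_norm norm_divide)
  interpret eigenvalue_compact_resolvent H T z0 "lam i"
    unfolding H T using z0 DB.compact_resolvent by unfold_locales (auto simp: H T)
  \<comment> \<open>\<open>C\<close> is fixed before h, r and u, so one constant serves all
    functions and contours.\<close>
  obtain C where C: "C > 0" and bound: "\<And>h r u. h holomorphic_on ball (lam i) R \<Longrightarrow> 0 < r \<Longrightarrow> r < R \<Longrightarrow> u \<in> H \<Longrightarrow>
    norm (curve_integral {0..1} (circlepath (lam i) r) (\<lambda>z. cscale (h z) (resolvent T z u)))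
      \<le> C * norm u * Max ((\<lambda>j. cmod ((deriv ^^ j) h (lam i))) ` {0..eigenvalue_index T (lam i) - 1})"
    using circle_integral_bound[OF \<open>0 < R\<close> sub] by blast
  have main: "op_norm H (functional_calculus N lam \<tau> r \<nu> b T h)
      \<le> ereal (C * Max ((\<lambda>j. cmod ((deriv ^^ j) h (lam i))) ` {0..eigenvalue_index T (lam i) - 1}))"
    if h: "h \<in> H_infinity \<Sigma>" and h0: "\<forall>z\<in>\<Sigma>. z \<notin> {\<zeta>. cmod (lam i - \<zeta>) < R} \<longrightarrow> h z = 0"
      and \<nu>: "\<omega> < \<nu>" "\<nu> < \<mu>" and r: "0 < r" "r < R" and b: "a < b" for h \<nu> r b
  proof -
    define Mx where "Mx = Max ((\<lambda>j. cmod ((deriv ^^ j) h (lam i))) ` {0..eigenvalue_index T (lam i) - 1})"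
    have ab: "0 < a" "0 < b" using \<open>0 < R\<close> \<open>R < a\<close> b by auto
    have tan: "0 < tan \<nu>" "tan \<nu> < tan \<mu>"
      using \<nu> \<omega>0 \<open>\<mu> < pi / 2\<close> by (auto intro: tan_gt_zero tan_monotone)
    have far: "h z = 0" if "\<bar>Re z\<bar> > a" "\<bar>Im z\<bar> < \<tau> + \<bar>Re z\<bar> * tan \<mu>" for z
    proof -
      have "z \<in> \<Sigma>" using that by (auto simp: \<Sigma> Sigma_dom_def Sigma_minus_def Sigma_plus_def abs_if split: if_splits)
      moreover have "\<not> cmod (lam i - z) < R"
        using small[of z] that(1) by (auto simp: dist_norm)
      ultimately show ?thesis using h0 by auto
    qed
    \<comment> \<open>The unbounded contours, including their corners and vertical segments, lie
      inside \<Sigma> because b > a and tan \<nu> < tan \<mu>; a point with real part at least b in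
      modulus therefore falls under \<open>far\<close>.\<close>
    have ray: "h z = 0" if "b \<le> \<bar>Re z\<bar>" "\<bar>Im z\<bar> \<le> \<tau> + \<bar>Re z\<bar> * tan \<nu>" for z
    proof (rule far)
      have "\<bar>Re z\<bar> * tan \<nu> < \<bar>Re z\<bar> * tan \<mu>"
        using that(1) ab tan by (intro mult_strict_left_mono) auto
      then show "\<bar>Im z\<bar> < \<tau> + \<bar>Re z\<bar> * tan \<mu>" using that(2) by linarith
    qed (use that b in auto)
    have wedge: "wedge_integral s \<tau> \<nu> b (\<lambda>z. cscale (h z) (resolvent T z u)) = 0"
      if s: "s = 1 \<or> s = - 1" for s u
    proof -
      have ReIm: "\<bar>Re (s * z)\<bar> = \<bar>Re z\<bar>" "\<bar>Im (s * z)\<bar> = \<bar>Im z\<bar>" for z using s by auto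
      have 1: "\<forall>t\<in>{..- b}. h (s * Complex (- t) (\<tau> - t * tan \<nu>)) = 0"
      proof
        fix t assume t: "t \<in> {..- b}"
        then have "t * tan \<nu> \<le> 0" using ab tan by (simp add: mult_nonpos_nonneg)
        then show "h (s * Complex (- t) (\<tau> - t * tan \<nu>)) = 0"
          using t ab \<open>\<tau> > 0\<close> by (intro ray) (unfold ReIm, auto simp: abs_if)
      qed
      have 2: "\<forall>t\<in>{-(\<tau> + b * tan \<nu>)..\<tau> + b * tan \<nu>}. h (s * Complex b (- t)) = 0"
        using ab by (intro ballI ray) (unfold ReIm, auto simp: abs_le_iff)
      have 3: "\<forall>t\<in>{b..}. h (s * Complex t (-(\<tau> + t * tan \<nu>))) = 0"
      proof
        fix t assume t: "t \<in> {b..}"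
        then have "t * tan \<nu> \<ge> 0" using ab tan by simp
        then show "h (s * Complex t (-(\<tau> + t * tan \<nu>))) = 0"
          using t ab \<open>\<tau> > 0\<close> by (intro ray) (unfold ReIm, auto simp: abs_if)
      qed
      have 0: "curve_integral I g (\<lambda>z. cscale (h z) (resolvent T z u)) = 0"
        if "\<forall>t\<in>I. h (g t) = 0" for I g
        by (rule curve_integral_eq_0) (simp add: that)
      show ?thesis
        unfolding wedge_integral_def 0[OF 1] 0[OF 2] 0[OF 3] by simp
    qed
    have circle: "curve_integral {0..1} (circlepath (lam j) r) (\<lambda>z. cscale (h z) (resolvent T z u)) = 0"
      if j: "j \<in> {1..N}" "j \<noteq> i" for j u
    proof (rule curve_integral_eq_0)
      fix t :: real assume "t \<in> {0..1}"
      then have "circlepath (lam j) r t \<in> path_image (circlepath (lam j) r)"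
        by (simp add: path_image_def)
      then have z: "circlepath (lam j) r t \<in> ball (lam j) R" using r by auto
      then have "circlepath (lam j) r t \<in> \<Sigma>"
        using j(1) by (auto simp: \<Sigma> Sigma_dom_def Sigma_zero_def)
      moreover have "circlepath (lam j) r t \<notin> ball (lam i) R"
        using disj[OF j, of "circlepath (lam j) r t"] z by auto
      ultimately have "h (circlepath (lam j) r t) = 0"
        using h0 by (auto simp: dist_norm)
      then show "cscale (h (circlepath (lam j) r t)) (resolvent T (circlepath (lam j) r t) u) = 0" by simp
    qed
    have hb: "h holomorphic_on ball (lam i) R"
      using h \<open>i \<in> {1..N}\<close> by (auto simp: H_infinity_def \<Sigma> Sigma_dom_def Sigma_zero_def
          elim!: holomorphic_on_subset)
    have "cmod ((deriv ^^ j) h (lam i)) \<le> Mx" if "j \<le> eigenvalue_index T (lam i) - 1" for j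
      unfolding Mx_def using that by (intro Max_ge) auto
    from this[of 0] have Mx0: "Mx \<ge> 0" by (intro order_trans[OF norm_ge_zero]) simp
    have "norm (functional_calculus N lam \<tau> r \<nu> b T h u) \<le> C * Mx" if u: "u \<in> H" "norm u \<le> 1" for u
    proof -
      define I where "I = curve_integral {0..1} (circlepath (lam i) r) (\<lambda>z. cscale (h z) (resolvent T z u))"
      have "(\<Sum>j\<in>{1..N}. curve_integral {0..1} (circlepath (lam j) r) (\<lambda>z. cscale (h z) (resolvent T z u))) = I"
        using \<open>i \<in> {1..N}\<close> circle by (subst sum.remove[of _ i]) (auto simp: I_def intro!: sum.neutral)
      then have "functional_calculus N lam \<tau> r \<nu> b T h u = cscale (1 / (2 * of_real pi * \<i>)) I"
        by (simp add: functional_calculus_def gamma_integral_def wedge)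
      then have "norm (functional_calculus N lam \<tau> r \<nu> b T h u) = 1 / (2 * pi) * norm I"
        by (simp add: norm_divide norm_mult)
      also have "\<dots> \<le> 1 * norm I"
        using pi_ge_two by (intro mult_right_mono) (auto simp: divide_le_eq)
      also have "norm I \<le> C * norm u * Mx" unfolding I_def Mx_def by (rule bound[OF hb r u(1)])
      also have "C * norm u * Mx \<le> C * 1 * Mx"
        using u(2) C Mx0 by (intro mult_right_mono mult_left_mono) auto
      finally show ?thesis by simp
    qed
    then show ?thesis unfolding op_norm_def Mx_def by (intro SUP_least) auto
  qed
  show ?thesis using C main by (intro exI[of _ C]) blast
qed

end
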